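(* Let $A,B$ be real analytic functions on an open interval $\mathcal I\subset\mathbb R$ with $0\in\mathcal I$, such that near $x=0$ $$A(x)=a^2+O(x),\qquad B(x)=\frac{x^2}{b^2}+O(x^3),$$ where $a,b$ are real constants with $ab\neq0$. Let $H(x,y)=A(x)y^2+B(x)$ and denote by $\gamma(h)\subset\{H(x,y)=h\}$, $h\in(0,\overline h)$, the periodic orbits surrounding the origin of the Hamiltonian system $\dot x=H_y(x,y)$, $\dot y=-H_x(x,y)$. Let $\ell\in\mathbb N$ and $q_j,p_j\in\mathbb N$ for $j=0,1,\ldots,\ell$, and for $d_0,d_1,\ldots,d_\ell\in\mathbb R$ consider the Abelian integral $$J(h)=\int_{\gamma(h)}\sum_{j=0}^{\ell}d_j\,x^{2q_j}y^{2p_j-1}\,dx,\qquad h\in(0,\overline h).$$ If all the values $m_j=q_j+p_j$, $j=0,1,\ldots,\ell$, are different, then there exist values of $d_j$, $j=0,1,\ldots,\ell$, such that the corresponding function $J(h)$ has at least $\ell$ simple zeroes in $(0,\overline h)$.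
   Context: The origin is a center of the Hamiltonian system (a singular point having a punctured neighbourhood filled with periodic orbits surrounding it) and lies at level $H=0$; $\gamma(h)$, $h\in(0,\overline h)$, denotes the continuum of periodic orbits surrounding it, parameterized by the energy level $h$ and oriented by the flow (clockwise). A zero $h^*$ of $J$ is simple if $J(h^* )=0$ and $J'(h^* )\ne0$. $\mathbb N$ denotes the positive integers. *)

theory Defs
  imports "HOL-Analysis.Analysis" "HOL-Library.Landau_Symbols" "HOL-Library.Extended_Real"
begin

definition real_analytic_on :: "(real \<Rightarrow> real) \<Rightarrow> real set \<Rightarrow> bool" where
  "real_analytic_on f S \<longleftrightarrow> (\<forall>x\<in>S. \<exists>F. (\<lambda>u. f (x + u)) has_fps_expansion F)"

definition hamiltonian_field :: "(real \<Rightarrow> real \<Rightarrow> real) \<Rightarrow> real \<times> real \<Rightarrow> real \<times> real" where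
  "hamiltonian_field H z =
     (deriv (\<lambda>y. H (fst z) y) (snd z), - deriv (\<lambda>x. H x (snd z)) (fst z))"

text \<open>
  Solutions are global in time and stay in the strip over \<open>I\<close>, the domain of \<open>H\<close>.  As \<open>T\<close> is the
  minimal period, \<open>g\<close> is not constant and runs through its orbit exactly once on \<open>{0..T}\<close>, in the
  direction of the flow.
\<close>

definition periodic_solution ::
    "real set \<Rightarrow> (real \<Rightarrow> real \<Rightarrow> real) \<Rightarrow> (real \<Rightarrow> real \<times> real) \<Rightarrow> real \<Rightarrow> bool" where
  "periodic_solution I H g T \<longleftrightarrow>
     (\<forall>t. fst (g t) \<in> I \<and> (g has_vector_derivative hamiltonian_field H (g t)) (at t)) \<and>
     0 < T \<and> (\<forall>t. g (t + T) = g t) \<and>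
     (\<forall>s. 0 < s \<and> s < T \<longrightarrow> \<not> (\<forall>t. g (t + s) = g t))"

text \<open>
  A family of periodic orbits around the origin, parameterized by the energy: \<open>\<gamma> h\<close> is a solution
  with minimal period \<open>T h\<close> tracing the orbit at level \<open>h\<close>.  The choice of the initial point on each
  orbit is left arbitrary.  The bound \<open>hbar\<close> may be \<open>\<infinity>\<close>.
\<close>

definition periodic_orbits_around_origin ::
    "real set \<Rightarrow> (real \<Rightarrow> real \<Rightarrow> real) \<Rightarrow> ereal \<Rightarrow> (real \<Rightarrow> real \<Rightarrow> real \<times> real) \<Rightarrow> (real \<Rightarrow> real) \<Rightarrow> bool"
  where
  "periodic_orbits_around_origin I H hbar \<gamma> T \<longleftrightarrow>
     (\<forall>h. 0 < h \<and> ereal h < hbar \<longrightarrow>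
        periodic_solution I H (\<gamma> h) (T h) \<and>
        range (\<gamma> h) \<subseteq> {(x, y). H x y = h} \<and>
        (0, 0) \<in> inside (range (\<gamma> h)))"

text \<open>The line integral of \<open>P(x,y) dx\<close> along the curve \<open>g\<close> on \<open>{0..T}\<close>.\<close>

definition line_integral_dx ::
    "(real \<Rightarrow> real \<Rightarrow> real) \<Rightarrow> (real \<Rightarrow> real \<times> real) \<Rightarrow> real \<Rightarrow> real" where
  "line_integral_dx P g T =
     integral {0..T} (\<lambda>t. P (fst (g t)) (snd (g t)) * deriv (\<lambda>s. fst (g s)) t)"

definition abelian_integral ::
    "nat \<Rightarrow> (nat \<Rightarrow> nat) \<Rightarrow> (nat \<Rightarrow> nat) \<Rightarrow> (nat \<Rightarrow> real) \<Rightarrow>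
     (real \<Rightarrow> real \<Rightarrow> real \<times> real) \<Rightarrow> (real \<Rightarrow> real) \<Rightarrow> real \<Rightarrow> real" where
  "abelian_integral l q p d \<gamma> T h =
     line_integral_dx (\<lambda>x y. \<Sum>j=0..l. d j * x ^ (2 * q j) * y ^ (2 * p j - 1)) (\<gamma> h) (T h)"

definition simple_zero :: "(real \<Rightarrow> real) \<Rightarrow> real \<Rightarrow> bool" where
  "simple_zero J h \<longleftrightarrow> J h = 0 \<and> (\<exists>D. (J has_real_derivative D) (at h) \<and> D \<noteq> 0)"

end

theory Submission
  imports Defs
begin

text \<open>
  Write \<open>B = k\<^sup>2\<close> with \<open>k\<close> a local coordinate at \<open>0\<close>. In the coordinates \<open>u = k x\<close>, \<open>v = sqrt (A x) * y\<close>
  the orbit at a small level \<open>h\<close> is the circle of radius \<open>sqrt h\<close>, run through with positive angular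
  velocity, and the integral of \<open>x ^ (2 * q) * y ^ (2 * p - 1)\<close> becomes \<open>h ^ (q + p) * K (sqrt h)\<close> with \<open>K\<close>
  continuously differentiable and \<open>K 0 > 0\<close>. Hence the terms of \<open>J\<close> have pairwise different orders at
  \<open>h = 0\<close>. Add them one by one in decreasing order, each with a coefficient so small that the simple
  zeros found before survive; every new term creates one more simple zero, much closer to \<open>0\<close>.
\<close>

subsection \<open>Simple zeros of linear combinations of functions of different orders\<close>

text \<open>\<open>periodic_orbits_around_origin\<close> says nothing about how
  \<open>\<gamma> h\<close> and \<open>T h\<close> vary with \<open>h\<close>, so the Abelian
  integral cannot be differentiated along the orbits. It is evaluated level by level instead; the
  resulting formula no longer mentions the curve, and it is this formula that is differentiated. For
  the evaluation an orbit must be exactly one turn of its circle: the angle satisfies an autonomous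
  periodic equation, so completing a turn returns to the same state, and minimality of the period
  rules out further turns. On the circle \<open>dx\<close> contributes one more factor
  \<open>y\<close>, so the exponents of sine and cosine are both even; the integrand of
  \<open>K 0\<close> has constant sign and the leading coefficient cannot cancel. Simplicity of the
  new zero comes from the orders: for a sum \<open>F\<close> of order \<open>m k\<close> and an
  added term \<open>g\<close> of lower order \<open>m k0\<close>, \<open>h\<close> times the
  logarithmic derivative of \<open>F / g\<close> tends to \<open>m k - m k0\<close>, which is not
  \<open>0\<close>. One continuous derivative suffices throughout; analyticity serves to build
  \<open>k\<close> and to make \<open>A\<close> and \<open>k'\<close> continuously
  differentiable.\<close>

lemma simple_zero_persists:
  fixes F F' f f' :: "real \<Rightarrow> real"
  assumes "open U" "z \<in> U"
    and dF: "\<And>s. s \<in> U \<Longrightarrow> (F has_real_derivative F' s) (at s)"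
    and df: "\<And>s. s \<in> U \<Longrightarrow> (f has_real_derivative f' s) (at s)"
    and cF: "continuous_on U F'" and cf: "continuous_on U f'"
    and z: "F z = 0" "F' z \<noteq> 0" and "0 < \<delta>"
  shows "\<forall>\<^sub>F \<epsilon> in nhds 0. \<exists>s\<in>U. \<bar>s - z\<bar> < \<delta> \<and> F s + \<epsilon> * f s = 0 \<and> F' s + \<epsilon> * f' s \<noteq> 0"
proof -
  \<comment> \<open>The factor \<open>\<sigma>\<close> reduces both signs of \<open>F' z\<close> to
    an increasing function. Near \<open>z\<close> the slope of \<open>\<sigma> * F\<close> exceeds
    \<open>c\<close> and \<open>f'\<close> stays below \<open>M\<close>, so the slope remains
    positive as long as \<open>\<bar>\<epsilon>\<bar> * M < c\<close>; the sign change between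
    \<open>z - \<rho>\<close> and \<open>z + \<rho>\<close> survives small \<open>\<epsilon>\<close>
    and yields the zero.\<close>
  define \<sigma> where "\<sigma> = sgn (F' z)"
  define c where "c = \<bar>F' z\<bar> / 2"
  define M where "M = \<bar>f' z\<bar> + 1"
  have "c > 0" "M > 0" using z by (auto simp: c_def M_def)
  have iF: "isCont F' z" and "isCont f' z"
    using cF cf assms(1,2) by (auto simp: continuous_on_eq_continuous_at)
  have "\<sigma> * F' z > c"
    using z by (auto simp: \<sigma>_def c_def sgn_if abs_if)
  then have e1: "\<forall>\<^sub>F s in nhds z. \<sigma> * F' s > c"
    using iF by (intro order_tendstoD(1)[of _ "\<sigma> * F' z"] tendsto_intros)
      (auto simp: isCont_def tendsto_at_iff_tendsto_nhds)
  have "\<bar>f' z\<bar> < M" by (auto simp: M_def)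
  then have e2: "\<forall>\<^sub>F s in nhds z. \<bar>f' s\<bar> < M"
    using \<open>isCont f' z\<close> by (intro order_tendstoD(2)[of _ "\<bar>f' z\<bar>"] tendsto_intros)
      (auto simp: isCont_def tendsto_at_iff_tendsto_nhds)
  have e3: "\<forall>\<^sub>F s in nhds z. s \<in> U"
    using assms(1,2) by (rule eventually_nhds_in_open)
  from eventually_conj[OF e1 eventually_conj[OF e2 e3]] obtain e where "e > 0"
    and e: "\<And>s. dist s z < e \<Longrightarrow> \<sigma> * F' s > c \<and> \<bar>f' s\<bar> < M \<and> s \<in> U"
    by (auto simp: eventually_nhds_metric)
  define \<rho> where "\<rho> = min e \<delta> / 2"
  have \<rho>: "\<rho> > 0" "\<rho> < e" "\<rho> < \<delta>" using \<open>e > 0\<close> \<open>0 < \<delta>\<close> by (auto simp: \<rho>_def)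
  have near: "\<sigma> * F' s > c" "\<bar>f' s\<bar> < M" "s \<in> U" if "\<bar>s - z\<bar> \<le> \<rho>" for s
    using e[of s] that \<rho> by (auto simp: dist_real_def)
  have d\<sigma>: "((\<lambda>s. \<sigma> * F s) has_real_derivative \<sigma> * F' s) (at s)" if "\<bar>s - z\<bar> \<le> \<rho>" for s
    using dF[OF near(3)[OF that]] by (auto intro!: derivative_eq_intros)
  have inc: "\<sigma> * F x < \<sigma> * F y" if "z - \<rho> \<le> x" "x < y" "y \<le> z + \<rho>" for x y
  proof (rule DERIV_pos_imp_increasing[OF that(2)])
    fix w assume "x \<le> w" "w \<le> y"
    then have w: "\<bar>w - z\<bar> \<le> \<rho>" using that by auto
    have "\<sigma> * F' w > 0" using near(1)[OF w] \<open>c > 0\<close> by linarith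
    then show "\<exists>y. ((\<lambda>s. \<sigma> * F s) has_real_derivative y) (at w) \<and> y > 0"
      using d\<sigma>[OF w] by blast
  qed
  have neg: "\<sigma> * F (z - \<rho>) < 0" and pos: "\<sigma> * F (z + \<rho>) > 0"
    using inc[of "z - \<rho>" z] inc[of z "z + \<rho>"] z(1) \<rho> by auto
  have t: "((\<lambda>\<epsilon>. \<sigma> * (F s + \<epsilon> * f s)) \<longlongrightarrow> \<sigma> * (F s + 0 * f s)) (nhds 0)" for s
    by (intro tendsto_intros filterlim_ident)
  have a1: "\<forall>\<^sub>F \<epsilon> in nhds 0. \<sigma> * (F (z - \<rho>) + \<epsilon> * f (z - \<rho>)) < 0"
    using order_tendstoD(2)[OF t] neg by simp
  have a2: "\<forall>\<^sub>F \<epsilon> in nhds 0. \<sigma> * (F (z + \<rho>) + \<epsilon> * f (z + \<rho>)) > 0"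
    using order_tendstoD(1)[OF t] pos by simp
  have a3: "\<forall>\<^sub>F \<epsilon> in nhds 0. \<bar>\<epsilon>\<bar> * M < c"
    by (rule order_tendstoD(2)[of _ "\<bar>0\<bar> * M"]) (use \<open>c > 0\<close> in \<open>auto intro!: tendsto_eq_intros filterlim_ident\<close>)
  show ?thesis
    using a1 a2 a3
  proof eventually_elim
    case (elim \<epsilon>)
    have "\<exists>s\<ge>z - \<rho>. s \<le> z + \<rho> \<and> \<sigma> * (F s + \<epsilon> * f s) = 0"
    proof (rule IVT)
      show "\<forall>x. z - \<rho> \<le> x \<and> x \<le> z + \<rho> \<longrightarrow> isCont (\<lambda>s. \<sigma> * (F s + \<epsilon> * f s)) x"
      proof (intro allI impI)
        fix x assume "z - \<rho> \<le> x \<and> x \<le> z + \<rho>"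
        then have "x \<in> U" using near(3)[of x] by (auto simp: abs_le_iff)
        then show "isCont (\<lambda>s. \<sigma> * (F s + \<epsilon> * f s)) x"
          using DERIV_isCont[OF dF] DERIV_isCont[OF df] by (intro continuous_intros) auto
      qed
    qed (use elim \<rho> in auto)
    then obtain s where "z - \<rho> \<le> s" "s \<le> z + \<rho>" "\<sigma> * (F s + \<epsilon> * f s) = 0" by blast
    then have s: "\<bar>s - z\<bar> \<le> \<rho>" "\<sigma> * (F s + \<epsilon> * f s) = 0" by linarith+
    have "\<sigma> \<noteq> 0" using z by (auto simp: \<sigma>_def sgn_if)
    moreover have "\<sigma> * (F' s + \<epsilon> * f' s) > 0"
    proof -
      have "\<bar>\<sigma> * (\<epsilon> * f' s)\<bar> \<le> \<bar>\<epsilon>\<bar> * M"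
        using near(2)[OF s(1)] by (auto simp: \<sigma>_def abs_mult sgn_if intro!: mult_left_mono)
      then show ?thesis using near(1)[OF s(1)] elim(3) by (simp add: distrib_left)
    qed
    ultimately show ?case using s near(3)[OF s(1)] \<rho> by (intro bexI[of _ s]) auto
  qed
qed

text \<open>The sum inherits the behaviour at \<open>0\<close> of its term \<open>k\<close> of lowest order; \<open>g\<close> stands for the
  functions themselves or for \<open>h\<close> times their derivatives.\<close>

lemma tendsto_sum_lowest_order:
  fixes g :: "'a \<Rightarrow> real \<Rightarrow> real" and m :: "'a \<Rightarrow> nat"
  assumes "finite S" "inj_on m S" "k \<in> S" "\<And>j. j \<in> S \<Longrightarrow> m k \<le> m j"
    and lim: "\<And>j. j \<in> S \<Longrightarrow> ((\<lambda>h. g j h / h ^ m j) \<longlongrightarrow> c j) (at_right 0)"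
  shows "((\<lambda>h. (\<Sum>j\<in>S. d j * g j h) / h ^ m k) \<longlongrightarrow> d k * c k) (at_right 0)"
proof -
  have "((\<lambda>h. \<Sum>j\<in>S. d j * (g j h / h ^ m j * h ^ (m j - m k))) \<longlongrightarrow>
      (\<Sum>j\<in>S. d j * (c j * 0 ^ (m j - m k)))) (at_right 0)"
    by (intro tendsto_intros lim)
  also have "(\<Sum>j\<in>S. d j * (c j * 0 ^ (m j - m k))) = (\<Sum>j\<in>S. if j = k then d k * c k else 0)"
  proof (rule sum.cong)
    fix j assume j: "j \<in> S"
    show "d j * (c j * 0 ^ (m j - m k)) = (if j = k then d k * c k else 0)"
    proof (cases "j = k")
      case False
      then have "m j \<noteq> m k" using assms(2,3) j by (auto dest: inj_onD)
      then show ?thesis using False assms(4)[OF j] by auto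
    qed auto
  qed auto
  also have "\<dots> = d k * c k" using assms(1,3) by simp
  finally have L: "((\<lambda>h. \<Sum>j\<in>S. d j * (g j h / h ^ m j * h ^ (m j - m k))) \<longlongrightarrow> d k * c k) (at_right 0)" .
  have "\<forall>\<^sub>F h in at_right 0. (\<Sum>j\<in>S. d j * (g j h / h ^ m j * h ^ (m j - m k))) =
      (\<Sum>j\<in>S. d j * g j h) / h ^ m k"
    using eventually_at_right_less[of "0::real"]
  proof eventually_elim
    case (elim h)
    have "h ^ m j = h ^ (m j - m k) * h ^ m k" if "j \<in> S" for j
      using assms(4)[OF that] by (simp flip: power_add)
    then show ?case using elim
      by (auto simp: sum_divide_distrib intro!: sum.cong)
  qed
  then show ?thesis by (rule Lim_transform_eventually[OF L])
qed

text \<open>Induction that splits off the index of least order. The nonzero coefficient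
  \<open>d k\<close> at the lowest order is part of the conclusion because the next step needs it:
  it gives the sum found so far the exact order \<open>m k\<close> at \<open>0\<close>, with nonzero
  leading coefficient \<open>d k * c k\<close>.\<close>

lemma exists_simple_zeros:
  fixes f f' :: "'a \<Rightarrow> real \<Rightarrow> real" and m :: "'a \<Rightarrow> nat"
  assumes "finite S" "S \<noteq> {}" "inj_on m S" "0 < h0"
    and "\<And>j h. j \<in> S \<Longrightarrow> h \<in> {0<..<h0} \<Longrightarrow> (f j has_real_derivative f' j h) (at h)"
    and "\<And>j. j \<in> S \<Longrightarrow> continuous_on {0<..<h0} (f' j)"
    and "\<And>j. j \<in> S \<Longrightarrow> c j \<noteq> 0"
    and "\<And>j. j \<in> S \<Longrightarrow> ((\<lambda>h. f j h / h ^ m j) \<longlongrightarrow> c j) (at_right 0)"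
    and "\<And>j. j \<in> S \<Longrightarrow> ((\<lambda>h. h * f' j h / h ^ m j) \<longlongrightarrow> real (m j) * c j) (at_right 0)"
  shows "\<exists>d Z k. finite Z \<and> Suc (card Z) = card S \<and> Z \<subseteq> {0<..<h0} \<and>
    (\<forall>z\<in>Z. (\<Sum>j\<in>S. d j * f j z) = 0 \<and> (\<Sum>j\<in>S. d j * f' j z) \<noteq> 0) \<and>
    k \<in> S \<and> (\<forall>j\<in>S. m k \<le> m j) \<and> d k \<noteq> 0"
  using assms
proof (induction "card S" arbitrary: S)
  case 0
  then show ?case by simp
next
  case (Suc n)
  note dj = Suc.prems(5) and cj = Suc.prems(6)
  define k0 where "k0 = arg_min_on m S"
  have k0: "k0 \<in> S" "\<And>j. j \<in> S \<Longrightarrow> m k0 \<le> m j"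
    using arg_min_if_finite(1)[OF Suc.prems(1,2), of m] arg_min_least[OF Suc.prems(1,2), of _ m]
    by (auto simp: k0_def)
  define S' where "S' = S - {k0}"
  have S: "S = insert k0 S'" "k0 \<notin> S'" "finite S'" using k0 Suc.prems by (auto simp: S'_def)
  show ?case
  proof (cases "S' = {}")
    case True
    then show ?thesis using S by (intro exI[of _ "\<lambda>_. 1"] exI[of _ "{}"] exI[of _ k0]) auto
  next
    case False
    have "n = card S'" using Suc.hyps(2) S by simp
    from Suc.hyps(1)[OF this S(3) False _ Suc.prems(4)] Suc.prems(3,5-9)
    obtain d Z k where Z: "finite Z" "Suc (card Z) = card S'" "Z \<subseteq> {0<..<h0}"
      and z: "\<And>z. z \<in> Z \<Longrightarrow> (\<Sum>j\<in>S'. d j * f j z) = 0 \<and> (\<Sum>j\<in>S'. d j * f' j z) \<noteq> 0"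
      and k: "k \<in> S'" "\<And>j. j \<in> S' \<Longrightarrow> m k \<le> m j" "d k \<noteq> 0"
      unfolding S(1) inj_on_insert by (smt (verit) insertCI)
    define F where "F = (\<lambda>h. \<Sum>j\<in>S'. d j * f j h)"
    define F' where "F' = (\<lambda>h. \<Sum>j\<in>S'. d j * f' j h)"
    define g where "g = f k0"
    define g' where "g' = f' k0"
    have dF: "(F has_real_derivative F' h) (at h)" if "h \<in> {0<..<h0}" for h
      unfolding F_def F'_def using dj that S
      by (auto intro!: derivative_eq_intros sum.cong)
    have dg: "(g has_real_derivative g' h) (at h)" if "h \<in> {0<..<h0}" for h
      using dj[OF k0(1) that] by (simp add: g_def g'_def)
    have cF: "continuous_on {0<..<h0} F'"
      unfolding F'_def using cj S by (intro continuous_intros) auto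
    have cg: "continuous_on {0<..<h0} g'" using cj k0 by (simp add: g'_def)
    have "m k \<noteq> m k0" using Suc.prems(3) k(1) S by (auto simp: inj_on_def)
    then have mk: "m k0 < m k" using k0(2)[of k] k(1) S by auto
    have ck: "c k \<noteq> 0" "c k0 \<noteq> 0" using Suc.prems(7) k(1) k0(1) S by auto
    have inj': "inj_on m S'" using Suc.prems(3) S by simp
    have F0: "((\<lambda>h. F h / h ^ m k) \<longlongrightarrow> d k * c k) (at_right 0)"
      unfolding F_def using Suc.prems(8) S k by (intro tendsto_sum_lowest_order inj') auto
    have "((\<lambda>h. (\<Sum>j\<in>S'. d j * (h * f' j h)) / h ^ m k) \<longlongrightarrow> d k * (m k * c k)) (at_right 0)"
      using Suc.prems(9) S k by (intro tendsto_sum_lowest_order inj') auto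
    then have F'0: "((\<lambda>h. h * F' h / h ^ m k) \<longlongrightarrow> d k * (m k * c k)) (at_right 0)"
      by (simp add: F'_def sum_distrib_left mult.left_commute)
    have g0: "((\<lambda>h. g h / h ^ m k0) \<longlongrightarrow> c k0) (at_right 0)"
      and g'0: "((\<lambda>h. h * g' h / h ^ m k0) \<longlongrightarrow> m k0 * c k0) (at_right 0)"
      using Suc.prems(8,9) k0(1) by (auto simp: g_def g'_def)
    have pos: "\<forall>\<^sub>F h in at_right 0. (0::real) < h" by (rule eventually_at_right_less)
    have gnz: "\<forall>\<^sub>F h in at_right 0. g h \<noteq> 0"
      using tendsto_imp_eventually_ne[OF g0 ck(2)] by eventually_elim auto
    have quot: "((\<lambda>h. (F h / h ^ m k) / (g h / h ^ m k0)) \<longlongrightarrow> d k * c k / c k0) (at_right 0)"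
      by (intro tendsto_intros F0 g0 ck)
    have "((\<lambda>h. (F h / h ^ m k) / (g h / h ^ m k0) * h ^ (m k - m k0)) \<longlongrightarrow>
        d k * c k / c k0 * 0 ^ (m k - m k0)) (at_right 0)"
      by (intro tendsto_intros quot)
    moreover have "\<forall>\<^sub>F h in at_right 0.
        (F h / h ^ m k) / (g h / h ^ m k0) * h ^ (m k - m k0) = F h / g h"
      using pos
    proof eventually_elim
      case (elim h)
      have "h ^ m k = h ^ (m k - m k0) * h ^ m k0" using mk by (simp flip: power_add)
      then show ?case using elim by simp
    qed
    ultimately have "((\<lambda>h. F h / g h) \<longlongrightarrow> d k * c k / c k0 * 0 ^ (m k - m k0)) (at_right 0)"
      by (rule Lim_transform_eventually)
    moreover have "(0::real) ^ (m k - m k0) = 0" using mk by simp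
    ultimately have "((\<lambda>h. F h / g h) \<longlongrightarrow> 0) (at_right 0)" by simp
    \<comment> \<open>Persistence of the old zeros holds for all \<open>\<epsilon>\<close> near
      \<open>0\<close>; this limit transfers it to the coefficient \<open>- F h / g h\<close> for
      small \<open>h\<close>.\<close>
    then have \<epsilon>0: "filterlim (\<lambda>h. - F h / g h) (nhds 0) (at_right 0)"
      using tendsto_minus by fastforce
    \<comment> \<open>The function is \<open>h * (F' h - F h / g h * g' h) / h ^ m k\<close>, a
      rescaled derivative of the new sum at its prescribed zero \<open>h\<close>. Its limit contains
      the factor \<open>m k - m k0\<close>, so distinct orders make that zero simple.\<close>
    have "((\<lambda>h. h * F' h / h ^ m k - (F h / h ^ m k) / (g h / h ^ m k0) * (h * g' h / h ^ m k0)) \<longlongrightarrow>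
        d k * (m k * c k) - d k * c k / c k0 * (m k0 * c k0)) (at_right 0)"
      by (intro tendsto_intros quot F'0 g'0)
    also have "d k * (m k * c k) - d k * c k / c k0 * (m k0 * c k0) = d k * c k * (m k - real (m k0))"
      using ck by (simp add: algebra_simps)
    finally have "\<forall>\<^sub>F h in at_right 0.
        h * F' h / h ^ m k - (F h / h ^ m k) / (g h / h ^ m k0) * (h * g' h / h ^ m k0) \<noteq> 0"
      by (rule tendsto_imp_eventually_ne) (use ck k mk in auto)
    with pos have simple: "\<forall>\<^sub>F h in at_right 0. F' h + (- F h / g h) * g' h \<noteq> 0"
    proof eventually_elim
      case (elim h)
      have "h * F' h / h ^ m k - (F h / h ^ m k) / (g h / h ^ m k0) * (h * g' h / h ^ m k0) =
          h / h ^ m k * (F' h + (- F h / g h) * g' h)"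
        using elim by (simp add: field_simps)
      then show ?case using elim(2) by fastforce
    qed
    \<comment> \<open>A gap of \<open>2 * \<delta>\<close> keeps zeros that move by less than
      \<open>\<delta>\<close> distinct. The point \<open>0\<close> is included so that the moved
      zeros stay above \<open>\<delta>\<close>, while the new zero is taken below it.\<close>
    have "\<forall>\<^sub>F \<delta> in at_right (0::real). \<forall>x\<in>insert 0 Z. \<forall>y\<in>insert 0 Z. x \<noteq> y \<longrightarrow> 2 * \<delta> < \<bar>x - y\<bar>"
    proof (intro eventually_ball_finite ballI, goal_cases)
      case (3 x y)
      show ?case
      proof (cases "x = y")
        case False
        then have "\<forall>\<^sub>F \<delta> in at_right (0::real). 2 * \<delta> < \<bar>x - y\<bar>"
          by (intro order_tendstoD(2)[of _ "2 * 0"] tendsto_intros) auto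
        then show ?thesis by eventually_elim auto
      qed auto
    qed (use Z in auto)
    with pos have "\<forall>\<^sub>F \<delta> in at_right (0::real).
        0 < \<delta> \<and> (\<forall>x\<in>insert 0 Z. \<forall>y\<in>insert 0 Z. x \<noteq> y \<longrightarrow> 2 * \<delta> < \<bar>x - y\<bar>)"
      by eventually_elim auto
    then obtain \<delta> where "0 < \<delta>"
      and \<delta>: "\<And>x y. x \<in> insert 0 Z \<Longrightarrow> y \<in> insert 0 Z \<Longrightarrow> x \<noteq> y \<Longrightarrow> 2 * \<delta> < \<bar>x - y\<bar>"
      using eventually_happens'[OF trivial_limit_at_right_real] by blast
    have "\<forall>\<^sub>F \<epsilon> in nhds 0. \<forall>z\<in>Z. \<exists>s\<in>{0<..<h0}. \<bar>s - z\<bar> < \<delta> \<and>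
        F s + \<epsilon> * g s = 0 \<and> F' s + \<epsilon> * g' s \<noteq> 0"
    proof (intro eventually_ball_finite ballI Z simple_zero_persists[OF _ _ dF dg cF cg] \<open>0 < \<delta>\<close>)
      fix w assume "w \<in> Z"
      then show "F w = 0" "F' w \<noteq> 0" "w \<in> {0<..<h0}"
        using z[of w] Z by (auto simp: F_def F'_def)
    qed auto
    from eventually_compose_filterlim[OF this \<epsilon>0]
    have old: "\<forall>\<^sub>F h in at_right 0. \<forall>z\<in>Z. \<exists>s\<in>{0<..<h0}. \<bar>s - z\<bar> < \<delta> \<and>
        F s + (- F h / g h) * g s = 0 \<and> F' s + (- F h / g h) * g' s \<noteq> 0" .
    have Fnz: "\<forall>\<^sub>F h in at_right 0. F h \<noteq> 0"
      using tendsto_imp_eventually_ne[OF F0, of 0] ck k(3) by (auto elim: eventually_mono)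
    have small: "\<forall>\<^sub>F h in at_right 0. 0 < h \<and> h < \<delta> \<and> h < h0"
      using \<open>0 < \<delta>\<close> Suc.prems(4) by (auto simp: eventually_at_right intro!: exI[of _ "min \<delta> h0"])
    obtain h where h: "0 < h" "h < \<delta>" "h < h0" "g h \<noteq> 0" "F h \<noteq> 0"
      and hs: "F' h + (- F h / g h) * g' h \<noteq> 0"
      and ho: "\<And>z. z \<in> Z \<Longrightarrow> \<exists>s\<in>{0<..<h0}. \<bar>s - z\<bar> < \<delta> \<and>
        F s + (- F h / g h) * g s = 0 \<and> F' s + (- F h / g h) * g' s \<noteq> 0"
      using eventually_happens'[OF trivial_limit_at_right_real
          eventually_conj[OF small eventually_conj[OF gnz eventually_conj[OF simple eventually_conj[OF old Fnz]]]]]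
      by blast
    from ho obtain \<zeta> where \<zeta>: "\<And>z. z \<in> Z \<Longrightarrow> \<zeta> z \<in> {0<..<h0}" "\<And>z. z \<in> Z \<Longrightarrow> \<bar>\<zeta> z - z\<bar> < \<delta>"
      "\<And>z. z \<in> Z \<Longrightarrow> F (\<zeta> z) + (- F h / g h) * g (\<zeta> z) = 0 \<and> F' (\<zeta> z) + (- F h / g h) * g' (\<zeta> z) \<noteq> 0"
      by metis
    have inj: "inj_on \<zeta> Z"
    proof (rule inj_onI, rule ccontr)
      fix x y assume xy: "x \<in> Z" "y \<in> Z" "\<zeta> x = \<zeta> y" "x \<noteq> y"
      then show False using \<zeta>(2)[of x] \<zeta>(2)[of y] \<delta>[of x y] by auto
    qed
    have new: "h \<notin> \<zeta> ` Z"
    proof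
      assume "h \<in> \<zeta> ` Z"
      then obtain w where w: "w \<in> Z" "h = \<zeta> w" by auto
      then show False using \<zeta>(2)[of w] \<delta>[of w 0] h Z(3) by force
    qed
    \<comment> \<open>This coefficient makes \<open>h\<close> itself a zero, and it tends to \<open>0\<close> with \<open>h\<close>.\<close>
    define d' where "d' = d(k0 := - F h / g h)"
    have d': "(\<Sum>j\<in>S'. d' j * \<phi> j) = (\<Sum>j\<in>S'. d j * \<phi> j)" for \<phi> :: "'a \<Rightarrow> real"
      using S by (intro sum.cong) (auto simp: d'_def)
    have sums: "(\<Sum>j\<in>S. d' j * f j s) = F s + (- F h / g h) * g s"
      "(\<Sum>j\<in>S. d' j * f' j s) = F' s + (- F h / g h) * g' s" for s
      using S by (simp_all add: d' flip: g_def g'_def) (simp_all add: d'_def F_def F'_def)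
    show ?thesis
    proof (rule exI[of _ d'], rule exI[of _ "insert h (\<zeta> ` Z)"], rule exI[of _ k0], intro conjI)
      show "Suc (card (insert h (\<zeta> ` Z))) = card S"
        using new Z inj S by (simp add: card_image)
      show "\<forall>z\<in>insert h (\<zeta> ` Z). (\<Sum>j\<in>S. d' j * f j z) = 0 \<and> (\<Sum>j\<in>S. d' j * f' j z) \<noteq> 0"
        unfolding sums using hs h \<zeta>(3) by auto
      show "d' k0 \<noteq> 0" using h by (simp add: d'_def)
    qed (use Z h \<zeta> k0 in auto)
  qed
qed

subsection \<open>Rotations with positive angular velocity\<close>

lemma continuous_has_antiderivative:
  fixes f :: "real \<Rightarrow> real"
  assumes "continuous_on UNIV f"
  obtains F where "\<And>x. (F has_real_derivative f x) (at x)"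
proof -
  have "\<exists>F. \<forall>x::real. -\<infinity> < ereal x \<longrightarrow> ereal x < \<infinity> \<longrightarrow> (F has_vector_derivative f x) (at x)"
    using assms by (intro einterval_antiderivative) (auto simp: continuous_on_eq_continuous_at)
  then show ?thesis
    using that by (auto simp: has_real_derivative_iff_has_vector_derivative)
qed

text \<open>Makes quantities accumulated over one turn independent of the starting angle; applied
  both to the time of a turn and to the integral over it.\<close>

lemma periodic_antiderivative_increment:
  fixes F f :: "real \<Rightarrow> real"
  assumes "\<And>x. (F has_real_derivative f x) (at x)" and "\<And>x. f (x + c) = f x"
  shows "F (x + c) - F x = F (y + c) - F y"
proof -
  have "((\<lambda>x. F (x + c) - F x) has_real_derivative 0) (at x)" for x
  proof -
    have "((\<lambda>x. F (x + c)) has_real_derivative f (x + c)) (at x)"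
      using assms(1)[of "x + c"] by (simp add: DERIV_shift)
    from DERIV_diff[OF this assms(1)[of x]] show ?thesis by (simp add: assms(2))
  qed
  then show ?thesis by (rule DERIV_isconst_all[rule_format])
qed

text \<open>For any antiderivative \<open>\<phi>\<close> of \<open>\<omega>\<close>, rotating
  \<open>(v, u)\<close> back by \<open>\<phi>\<close> gives a vector \<open>(P, Q)\<close> that does
  not move; its polar angle \<open>c\<close> is the missing phase. The angle is measured from the
  \<open>v\<close> axis, so that it increases along the clockwise flow when \<open>\<omega>\<close>
  is positive.\<close>

lemma rotation_polar_angle:
  fixes u v \<omega> :: "real \<Rightarrow> real"
  assumes "continuous_on UNIV \<omega>"
    and u: "\<And>t. (u has_real_derivative \<omega> t * v t) (at t)"
    and v: "\<And>t. (v has_real_derivative - (\<omega> t * u t)) (at t)"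
    and r: "\<And>t. (u t)\<^sup>2 + (v t)\<^sup>2 = r\<^sup>2" "0 < r"
  obtains \<theta> where "\<And>t. (\<theta> has_real_derivative \<omega> t) (at t)"
    "\<And>t. u t = r * sin (\<theta> t)" "\<And>t. v t = r * cos (\<theta> t)"
proof -
  obtain \<phi> where \<phi>: "\<And>t. (\<phi> has_real_derivative \<omega> t) (at t)"
    using continuous_has_antiderivative[OF assms(1)] by blast
  define P where "P t = v t * cos (\<phi> t) + u t * sin (\<phi> t)" for t
  define Q where "Q t = u t * cos (\<phi> t) - v t * sin (\<phi> t)" for t
  have "(P has_real_derivative 0) (at t)" for t
    unfolding P_def[abs_def]
    by (rule derivative_eq_intros refl u v \<phi>)+ (simp add: algebra_simps)
  then have P: "P t = P 0" for t by (rule DERIV_isconst_all[rule_format])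
  have "(Q has_real_derivative 0) (at t)" for t
    unfolding Q_def[abs_def]
    by (rule derivative_eq_intros refl u v \<phi>)+ (simp add: algebra_simps)
  then have Q: "Q t = Q 0" for t by (rule DERIV_isconst_all[rule_format])
  have "(P 0)\<^sup>2 + (Q 0)\<^sup>2 = ((u 0)\<^sup>2 + (v 0)\<^sup>2) * ((sin (\<phi> 0))\<^sup>2 + (cos (\<phi> 0))\<^sup>2)"
    unfolding P_def Q_def by algebra
  then have "(P 0 / r)\<^sup>2 + (Q 0 / r)\<^sup>2 = 1"
    using r by (simp add: power_divide flip: add_divide_distrib)
  then obtain c where c: "P 0 / r = cos c" "Q 0 / r = sin c"
    by (rule sincos_total_2pi) blast
  have "u t = r * sin (\<phi> t + c)" "v t = r * cos (\<phi> t + c)" for t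
  proof -
    have "u t = u t * ((sin (\<phi> t))\<^sup>2 + (cos (\<phi> t))\<^sup>2)" by simp
    also have "\<dots> = Q t * cos (\<phi> t) + P t * sin (\<phi> t)" unfolding P_def Q_def by algebra
    also have "\<dots> = r * sin (\<phi> t + c)" using c r P[of t] Q[of t] by (simp add: sin_add field_simps)
    finally show "u t = r * sin (\<phi> t + c)" .
    have "v t = v t * ((sin (\<phi> t))\<^sup>2 + (cos (\<phi> t))\<^sup>2)" by simp
    also have "\<dots> = P t * cos (\<phi> t) - Q t * sin (\<phi> t)" unfolding P_def Q_def by algebra
    also have "\<dots> = r * cos (\<phi> t + c)" using c r P[of t] Q[of t] by (simp add: cos_add field_simps)
    finally show "v t = r * cos (\<phi> t + c)" .
  qed
  moreover have "((\<lambda>t. \<phi> t + c) has_real_derivative \<omega> t) (at t)" for t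
    by (rule derivative_eq_intros refl \<phi>)+ simp
  ultimately show ?thesis using that by blast
qed

text \<open>\<open>F\<close> measures the time that the autonomous equation \<open>\<theta>' = w \<theta>\<close> needs to reach an angle.\<close>

lemma autonomous_angle_shift:
  fixes \<theta> w :: "real \<Rightarrow> real"
  assumes \<theta>: "\<And>t. (\<theta> has_real_derivative w (\<theta> t)) (at t)"
    and "continuous_on UNIV w" and pos: "\<And>x. 0 < w x" and per: "\<And>x. w (x + c) = w x"
    and s: "\<theta> s = \<theta> 0 + c"
  shows "\<theta> (t + s) = \<theta> t + c"
proof -
  have nz: "w x \<noteq> 0" for x using pos[of x] by simp
  have "continuous_on UNIV (\<lambda>x. 1 / w x)" using assms(2) nz by (intro continuous_intros) auto
  then obtain F where F: "\<And>x. (F has_real_derivative 1 / w x) (at x)"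
    using continuous_has_antiderivative by blast
  have "((\<lambda>t. F (\<theta> t) - t) has_real_derivative 0) (at t)" for t
    by (rule derivative_eq_intros refl \<theta> DERIV_chain'[OF \<theta> F])+ (simp add: nz)
  then have time: "F (\<theta> t) - t = F (\<theta> t') - t'" for t t'
    by (rule DERIV_isconst_all[rule_format])
  \<comment> \<open>Since \<open>1 / w\<close> has period \<open>c\<close>, advancing by
    \<open>c\<close> takes the time \<open>s\<close> from every angle; strict monotonicity of
    \<open>F\<close> turns equal times into equal angles.\<close>
  have "F (\<theta> t + c) - F (\<theta> t) = F (\<theta> 0 + c) - F (\<theta> 0)"
    by (rule periodic_antiderivative_increment[OF F]) (simp add: per)
  also have "\<dots> = s" using time[of s 0] s by simp
  also have "\<dots> = F (\<theta> (t + s)) - F (\<theta> t)" using time[of "t + s" t] by simp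
  finally have eq: "F (\<theta> t + c) = F (\<theta> (t + s))" by simp
  have mono: "F x < F y" if "x < y" for x y
    using F pos by (intro DERIV_pos_imp_increasing[OF that]) (metis divide_pos_pos zero_less_one)
  show ?thesis using eq mono[of "\<theta> t + c" "\<theta> (t + s)"] mono[of "\<theta> (t + s)" "\<theta> t + c"] by linarith
qed

text \<open>Substitution of the angle for the time, by the chain rule for an antiderivative of
  \<open>f\<close>; periodicity then moves the starting angle from \<open>\<theta> 0\<close> to
  \<open>-pi\<close>.\<close>

lemma integral_over_period:
  fixes \<theta> f \<omega> :: "real \<Rightarrow> real"
  assumes \<theta>: "\<And>t. (\<theta> has_real_derivative \<omega> t) (at t)"
    and "continuous_on UNIV f" and per: "\<And>x. f (x + 2 * pi) = f x"
    and T: "0 \<le> T" "\<theta> T = \<theta> 0 + 2 * pi"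
  shows "((\<lambda>t. f (\<theta> t) * \<omega> t) has_integral integral {-pi..pi} f) {0..T}"
proof -
  obtain F where F: "\<And>x. (F has_real_derivative f x) (at x)"
    using continuous_has_antiderivative[OF assms(2)] by blast
  have "((\<lambda>t. f (\<theta> t) * \<omega> t) has_integral F (\<theta> T) - F (\<theta> 0)) {0..T}"
  proof (rule fundamental_theorem_of_calculus[OF T(1)])
    fix t
    have "((\<lambda>t. F (\<theta> t)) has_real_derivative f (\<theta> t) * \<omega> t) (at t)"
      by (rule DERIV_chain'[OF \<theta> F, THEN DERIV_cong]) simp
    then show "((\<lambda>t. F (\<theta> t)) has_vector_derivative f (\<theta> t) * \<omega> t) (at t within {0..T})"
      by (simp add: has_real_derivative_iff_has_vector_derivative has_vector_derivative_at_within)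
  qed
  moreover have "F (\<theta> T) - F (\<theta> 0) = F (- pi + 2 * pi) - F (- pi)"
    unfolding T(2) by (rule periodic_antiderivative_increment[OF F per])
  moreover have "(f has_integral F pi - F (- pi)) {-pi..pi}"
    using F by (intro fundamental_theorem_of_calculus)
      (auto simp: has_real_derivative_iff_has_vector_derivative has_vector_derivative_at_within)
  ultimately show ?thesis by (simp add: integral_unique)
qed

subsection \<open>Trigonometric moments depending on the radius\<close>

lemma trig_moment_integral:
  fixes g g' :: "real \<Rightarrow> real" and q p :: nat
  defines "w \<equiv> \<lambda>\<theta>. sin \<theta> ^ (2 * q) * cos \<theta> ^ (2 * p)"
  defines "K \<equiv> \<lambda>r. integral {-pi..pi} (\<lambda>\<theta>. w \<theta> * g (r * sin \<theta>))"
    and "K' \<equiv> \<lambda>r. integral {-pi..pi} (\<lambda>\<theta>. w \<theta> * (g' (r * sin \<theta>) * sin \<theta>))"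
  assumes "0 < R"
    and g: "\<And>x. x \<in> {-R<..<R} \<Longrightarrow> (g has_real_derivative g' x) (at x)"
    and cg: "continuous_on {-R<..<R} g'"
  shows "\<And>r. r \<in> {-R<..<R} \<Longrightarrow> (K has_real_derivative K' r) (at r)"
    and "continuous_on {-R<..<R} K'"
    and "0 < g 0 \<Longrightarrow> 0 < K 0"
proof -
  have in_R: "r * sin \<theta> \<in> {-R<..<R}" if "r \<in> {-R<..<R}" for r \<theta>
  proof -
    have "\<bar>r * sin \<theta>\<bar> \<le> \<bar>r\<bar> * 1" unfolding abs_mult by (intro mult_left_mono) auto
    also have "\<dots> < R" using that by auto
    finally show ?thesis by auto
  qed
  have c2: "continuous_on {-R<..<R} g"
    using g by (intro DERIV_continuous_on) (blast intro: has_field_derivative_at_within)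
  have cw: "continuous_on X w" for X unfolding w_def by (intro continuous_intros)
  have cw2: "continuous_on X (\<lambda>x. w (snd x))" for X :: "(real \<times> real) set"
    unfolding w_def by (intro continuous_intros)
  have cont: "continuous_on ({-R<..<R} \<times> cbox (-pi) pi) (\<lambda>(r, \<theta>). w \<theta> * (g' (r * sin \<theta>) * sin \<theta>))"
    unfolding split_beta
    by (intro continuous_intros cw2 continuous_on_compose2[OF cg]) (use in_R in auto)
  show "(K has_real_derivative K' r) (at r)" if r: "r \<in> {-R<..<R}" for r
  proof -
    have "((\<lambda>r. integral (cbox (-pi) pi) (\<lambda>\<theta>. w \<theta> * g (r * sin \<theta>))) has_field_derivative
        integral (cbox (-pi) pi) (\<lambda>\<theta>. w \<theta> * (g' (r * sin \<theta>) * sin \<theta>))) (at r within {-R<..<R})"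
    proof (rule leibniz_rule_field_derivative[OF _ _ cont r])
      fix x t assume x: "x \<in> {-R<..<R}"
      have "((\<lambda>x. g (x * sin t)) has_real_derivative g' (x * sin t) * sin t) (at x)"
        by (rule DERIV_chain2[where f = g]) (use g[OF in_R[OF x]] in \<open>auto intro!: derivative_eq_intros\<close>)
      then have "((\<lambda>x. w t * g (x * sin t)) has_real_derivative w t * (g' (x * sin t) * sin t)) (at x)"
        by (rule DERIV_cmult)
      then show "((\<lambda>x. w t * g (x * sin t)) has_real_derivative w t * (g' (x * sin t) * sin t))
          (at x within {-R<..<R})" by (rule has_field_derivative_at_within)
    next
      fix x assume x: "x \<in> {-R<..<R}"
      show "(\<lambda>\<theta>. w \<theta> * g (x * sin \<theta>)) integrable_on cbox (-pi) pi"
        by (intro integrable_continuous continuous_intros cw continuous_on_compose2[OF c2])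
          (use in_R[OF x] in auto)
    qed auto
    then show ?thesis
      using at_within_open[OF r] by (simp add: K_def K'_def)
  qed
  show "continuous_on {-R<..<R} K'"
    using integral_continuous_on_param[OF cont] by (simp add: K'_def)
  show "0 < K 0" if "0 < g 0"
  proof -
    have c: "continuous_on {-pi..pi} (\<lambda>\<theta>. w \<theta> * g (0 * sin \<theta>))"
      unfolding mult_zero_left by (intro continuous_intros cw)
    have nn: "0 \<le> w \<theta> * g (0 * sin \<theta>)" for \<theta>
      using that by (auto simp: w_def)
    \<comment> \<open>An angle at which neither sine nor cosine vanishes: a continuous nonnegative
      integrand that is positive somewhere has nonzero integral.\<close>
    have "w (pi / 4) * g 0 \<noteq> 0" using that by (simp add: w_def sin_45 cos_45)
    then have "K 0 \<noteq> 0"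
      unfolding K_def using integral_eq_0_iff[OF c _ nn]
      by (auto dest!: bspec[of _ _ "pi / 4"] simp: not_le)
    moreover have "0 \<le> K 0" unfolding K_def
      by (intro integral_nonneg integrable_continuous_interval c nn)
    ultimately show ?thesis by simp
  qed
qed

text \<open>Differentiating \<open>sqrt h\<close> costs a factor \<open>1 / (2 * sqrt h)\<close>,
  but \<open>h\<close> times it is \<open>sqrt h / 2\<close>. Hence \<open>h * f' h / h ^ m\<close>
  differs from \<open>m * K (sqrt h)\<close> by a term that vanishes at \<open>0\<close>, which is
  why orders of derivatives are measured after multiplication by \<open>h\<close>.\<close>

lemma power_times_sqrt_asymptotics:
  fixes K K' :: "real \<Rightarrow> real" and m :: nat
  defines "f \<equiv> \<lambda>h. h ^ m * K (sqrt h)"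
    and "f' \<equiv> \<lambda>h. real m * h ^ (m - 1) * K (sqrt h) + h ^ m * (K' (sqrt h) / (2 * sqrt h))"
  assumes "0 < R" "1 \<le> m"
    and K: "\<And>r. r \<in> {-R<..<R} \<Longrightarrow> (K has_real_derivative K' r) (at r)"
    and cK': "continuous_on {-R<..<R} K'"
  shows "\<And>h. h \<in> {0<..<R\<^sup>2} \<Longrightarrow> (f has_real_derivative f' h) (at h)"
    and "continuous_on {0<..<R\<^sup>2} f'"
    and "((\<lambda>h. f h / h ^ m) \<longlongrightarrow> K 0) (at_right 0)"
    and "((\<lambda>h. h * f' h / h ^ m) \<longlongrightarrow> m * K 0) (at_right 0)"
proof -
  have in_R: "sqrt h \<in> {-R<..<R}" if "h \<in> {0<..<R\<^sup>2}" for h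
    using that \<open>0 < R\<close> by (auto simp: real_less_lsqrt intro: less_trans[of _ 0])
  have cK: "continuous_on {-R<..<R} K"
    using K by (intro DERIV_continuous_on) (blast intro: has_field_derivative_at_within)
  show "(f has_real_derivative f' h) (at h)" if h: "h \<in> {0<..<R\<^sup>2}" for h
  proof -
    have "((\<lambda>h. K (sqrt h)) has_real_derivative K' (sqrt h) * (inverse (sqrt h) / 2)) (at h)"
      by (rule DERIV_chain2[where f = K]) (use h K[OF in_R[OF h]] in \<open>auto intro!: DERIV_real_sqrt\<close>)
    from DERIV_mult[OF DERIV_pow[of m h] this] show ?thesis
      unfolding f_def f'_def by (rule DERIV_cong) (simp add: field_simps)
  qed
  show "continuous_on {0<..<R\<^sup>2} f'"
    unfolding f'_def
    by (intro continuous_intros continuous_on_compose2[OF cK] continuous_on_compose2[OF cK'])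
      (use in_R in auto)
  have s0: "((\<lambda>h. sqrt h) \<longlongrightarrow> 0) (at_right 0)" by (auto intro!: tendsto_eq_intros)
  have "isCont K 0" "isCont K' 0"
    using cK cK' \<open>0 < R\<close> by (auto simp: continuous_on_eq_continuous_at)
  then have KL: "((\<lambda>h. K (sqrt h)) \<longlongrightarrow> K 0) (at_right 0)"
    and K'L: "((\<lambda>h. K' (sqrt h)) \<longlongrightarrow> K' 0) (at_right 0)"
    using s0 by (auto intro: isCont_tendsto_compose)
  have pos: "\<forall>\<^sub>F h in at_right (0::real). 0 < h" by (rule eventually_at_right_less)
  show "((\<lambda>h. f h / h ^ m) \<longlongrightarrow> K 0) (at_right 0)"
    by (rule Lim_transform_eventually[OF KL]) (use pos in \<open>eventually_elim, simp add: f_def\<close>)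
  have "((\<lambda>h. m * K (sqrt h) + sqrt h * K' (sqrt h) / 2) \<longlongrightarrow> m * K 0 + 0 * K' 0 / 2) (at_right 0)"
    by (intro tendsto_intros KL K'L s0) simp
  moreover have "\<forall>\<^sub>F h in at_right 0. m * K (sqrt h) + sqrt h * K' (sqrt h) / 2 = h * f' h / h ^ m"
    using pos
  proof eventually_elim
    case (elim h)
    have "h / sqrt h = sqrt h" using elim by (simp add: real_div_sqrt)
    moreover have "h ^ m = h * h ^ (m - 1)" using \<open>1 \<le> m\<close> by (cases m) auto
    ultimately show ?case using elim by (simp add: f'_def field_simps)
  qed
  ultimately show "((\<lambda>h. h * f' h / h ^ m) \<longlongrightarrow> m * K 0) (at_right 0)"
    by (auto intro: Lim_transform_eventually)
qed

subsection \<open>Continuously differentiable functions\<close>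

text \<open>The derivative is hidden behind an existential, so that closure rules compose without
  spelling out derivatives of long quotients such as \<open>g q p\<close>. It is the two-sided
  derivative \<open>at x\<close>; the sets used are open.\<close>

definition C1_on :: "(real \<Rightarrow> real) \<Rightarrow> real set \<Rightarrow> bool" where
  "C1_on f U \<longleftrightarrow> (\<exists>f'. (\<forall>x\<in>U. (f has_real_derivative f' x) (at x)) \<and> continuous_on U f')"

lemma C1_onI:
  assumes "\<And>x. x \<in> U \<Longrightarrow> (f has_real_derivative f' x) (at x)" "continuous_on U f'"
  shows "C1_on f U"
  unfolding C1_on_def using assms by (intro exI[of _ f'] conjI ballI)

lemma C1_on_imp_continuous_on:
  assumes "C1_on f U"
  shows "continuous_on U f"
proof -
  obtain f' where f': "(\<forall>x\<in>U. (f has_real_derivative f' x) (at x)) \<and> continuous_on U f'"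
    using assms unfolding C1_on_def by (rule exE)
  show ?thesis
  proof (rule DERIV_continuous_on)
    fix x assume "x \<in> U"
    with f' have "(f has_real_derivative f' x) (at x)" by simp
    then show "(f has_real_derivative f' x) (at x within U)" by (rule has_field_derivative_at_within)
  qed
qed

lemma C1_on_const: "C1_on (\<lambda>x. c) U"
  by (rule C1_onI[OF DERIV_const continuous_on_const])

lemma C1_on_id: "C1_on (\<lambda>x. x) U"
  by (rule C1_onI[OF DERIV_ident continuous_on_const])

lemma C1_on_add:
  assumes "C1_on f U" "C1_on g U"
  shows "C1_on (\<lambda>x. f x + g x) U"
proof -
  obtain f' where "(\<forall>x\<in>U. (f has_real_derivative f' x) (at x)) \<and> continuous_on U f'"
    using assms(1) unfolding C1_on_def by (rule exE)
  then have f: "\<forall>x\<in>U. (f has_real_derivative f' x) (at x)" "continuous_on U f'" by simp_all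
  obtain g' where "(\<forall>x\<in>U. (g has_real_derivative g' x) (at x)) \<and> continuous_on U g'"
    using assms(2) unfolding C1_on_def by (rule exE)
  then have g: "\<forall>x\<in>U. (g has_real_derivative g' x) (at x)" "continuous_on U g'" by simp_all
  show ?thesis
  proof (rule C1_onI)
    show "((\<lambda>x. f x + g x) has_real_derivative f' x + g' x) (at x)" if "x \<in> U" for x
      using f(1)[rule_format, OF that] g(1)[rule_format, OF that] by (rule DERIV_add)
    show "continuous_on U (\<lambda>x. f' x + g' x)"
      by (intro continuous_on_add f g)
  qed
qed

lemma C1_on_mult:
  assumes "C1_on f U" "C1_on g U"
  shows "C1_on (\<lambda>x. f x * g x) U"
proof -
  obtain f' where "(\<forall>x\<in>U. (f has_real_derivative f' x) (at x)) \<and> continuous_on U f'"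
    using assms(1) unfolding C1_on_def by (rule exE)
  then have f: "\<forall>x\<in>U. (f has_real_derivative f' x) (at x)" "continuous_on U f'" by simp_all
  obtain g' where "(\<forall>x\<in>U. (g has_real_derivative g' x) (at x)) \<and> continuous_on U g'"
    using assms(2) unfolding C1_on_def by (rule exE)
  then have g: "\<forall>x\<in>U. (g has_real_derivative g' x) (at x)" "continuous_on U g'" by simp_all
  show ?thesis
  proof (rule C1_onI)
    show "((\<lambda>x. f x * g x) has_real_derivative f' x * g x + g' x * f x) (at x)" if "x \<in> U" for x
      using f(1)[rule_format, OF that] g(1)[rule_format, OF that] by (rule DERIV_mult)
    show "continuous_on U (\<lambda>x. f' x * g x + g' x * f x)"
      by (intro continuous_on_add continuous_on_mult f g assms[THEN C1_on_imp_continuous_on])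
  qed
qed

lemma C1_on_power: "C1_on f U \<Longrightarrow> C1_on (\<lambda>x. f x ^ n) U"
  by (induction n) (simp_all add: C1_on_mult C1_on_const)

lemma C1_on_compose:
  assumes "C1_on f V" "C1_on g U" "\<And>x. x \<in> U \<Longrightarrow> g x \<in> V"
  shows "C1_on (\<lambda>x. f (g x)) U"
proof -
  obtain f' where "(\<forall>x\<in>V. (f has_real_derivative f' x) (at x)) \<and> continuous_on V f'"
    using assms(1) unfolding C1_on_def by (rule exE)
  then have f: "\<forall>x\<in>V. (f has_real_derivative f' x) (at x)" "continuous_on V f'" by simp_all
  obtain g' where "(\<forall>x\<in>U. (g has_real_derivative g' x) (at x)) \<and> continuous_on U g'"
    using assms(2) unfolding C1_on_def by (rule exE)
  then have g: "\<forall>x\<in>U. (g has_real_derivative g' x) (at x)" "continuous_on U g'" by simp_all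
  show ?thesis
  proof (rule C1_onI)
    show "((\<lambda>x. f (g x)) has_real_derivative f' (g x) * g' x) (at x)" if "x \<in> U" for x
      using f(1)[rule_format, OF assms(3)[OF that]] g(1)[rule_format, OF that] by (rule DERIV_chain2)
    have "continuous_on U (\<lambda>x. f' (g x))"
      using assms(3) by (intro continuous_on_compose2[OF f(2) C1_on_imp_continuous_on[OF assms(2)]]) blast
    then show "continuous_on U (\<lambda>x. f' (g x) * g' x)"
      using g(2) by (rule continuous_on_mult)
  qed
qed

lemma C1_on_inverse:
  assumes "C1_on f U" "\<And>x. x \<in> U \<Longrightarrow> f x \<noteq> 0"
  shows "C1_on (\<lambda>x. inverse (f x)) U"
proof -
  have "continuous_on (- {0}) (\<lambda>x::real. - (inverse x ^ Suc (Suc 0)))"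
    by (intro continuous_on_minus continuous_on_power continuous_on_inverse continuous_on_id) simp
  then have "C1_on inverse (- {0})"
    by (intro C1_onI[where f' = "\<lambda>x. - (inverse x ^ Suc (Suc 0))"] DERIV_inverse) simp_all
  then show ?thesis
    by (rule C1_on_compose[OF _ assms(1)]) (simp add: assms(2))
qed

lemma C1_on_divide:
  assumes "C1_on f U" "C1_on g U" "\<And>x. x \<in> U \<Longrightarrow> g x \<noteq> 0"
  shows "C1_on (\<lambda>x. f x / g x) U"
  unfolding divide_inverse using assms by (intro C1_on_mult C1_on_inverse)

lemma C1_on_sqrt:
  assumes "C1_on f U" "\<And>x. x \<in> U \<Longrightarrow> 0 < f x"
  shows "C1_on (\<lambda>x. sqrt (f x)) U"
proof -
  have "continuous_on {0<..} (\<lambda>x. inverse (sqrt x) / 2)"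
    by (intro continuous_on_divide continuous_on_inverse continuous_on_real_sqrt
        continuous_on_id continuous_on_const) simp_all
  then have "C1_on sqrt {0<..}"
    by (intro C1_onI[where f' = "\<lambda>x. inverse (sqrt x) / 2"] DERIV_real_sqrt) simp_all
  then show ?thesis
    by (rule C1_on_compose[OF _ assms(1)]) (simp add: assms(2))
qed

lemmas C1_intros = C1_on_const C1_on_id C1_on_add C1_on_mult C1_on_power C1_on_divide C1_on_sqrt

subsection \<open>Circular coordinates at the center\<close>

text \<open>\<open>k\<close> is the coordinate with \<open>B = k\<^sup>2\<close>; in the coordinates \<open>(k x, sqrt (A x) * y)\<close> the level
  curves of \<open>H\<close> are circles around the origin.\<close>

locale circular_chart =
  fixes A A' B k k' s :: "real \<Rightarrow> real" and D :: real
  assumes D: "0 < D"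
    and A: "\<And>x. x \<in> {-D<..<D} \<Longrightarrow> (A has_real_derivative A' x) (at x)"
    and cA': "continuous_on {-D<..<D} A'"
    and A_pos: "\<And>x. x \<in> {-D<..<D} \<Longrightarrow> 0 < A x"
    and k: "\<And>x. x \<in> {-D<..<D} \<Longrightarrow> (k has_real_derivative k' x) (at x)"
    and k'_C1: "C1_on k' {-D<..<D}"
    and k'_pos: "\<And>x. x \<in> {-D<..<D} \<Longrightarrow> 0 < k' x"
    and B: "\<And>x. x \<in> {-D<..<D} \<Longrightarrow> B x = (k x)\<^sup>2"
    and k_eq: "\<And>x. x \<in> {-D<..<D} \<Longrightarrow> k x = x * s x"
    and s_C1: "C1_on s {-D<..<D}"
    and s_pos: "\<And>x. x \<in> {-D<..<D} \<Longrightarrow> 0 < s x"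
begin

text \<open>Half of \<open>D\<close>, so that \<open>k\<close> can be inverted on a compact interval
  inside the domain of the chart.\<close>

definition \<delta> :: real where "\<delta> = D / 2"
text \<open>Half-width of the largest interval around \<open>0\<close> that is symmetric and lies in
  the image of \<open>{-\<delta>..\<delta>}\<close> under \<open>k\<close>; circles of smaller
  radius stay in the chart.\<close>

definition R :: real where "R = min (k \<delta>) (- k (- \<delta>))"
definition \<psi> :: "real \<Rightarrow> real" where "\<psi> = the_inv_into {-\<delta>..\<delta>} k"

text \<open>The angular velocity of the orbits in the coordinates \<open>(k x, sqrt (A x) * y)\<close>.\<close>

definition w :: "real \<Rightarrow> real" where "w x = 2 * k' x * sqrt (A x)"

lemma \<delta>: "0 < \<delta>" "\<delta> < D" using D by (auto simp: \<delta>_def)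

lemma A_C1: "C1_on A {-D<..<D}" using A cA' by (rule C1_onI)

lemma k_mono: "k x < k y" if "-D < x" "x < y" "y < D"
proof (rule DERIV_pos_imp_increasing[OF that(2)])
  fix z assume "x \<le> z" "z \<le> y"
  then have "z \<in> {-D<..<D}" using that by auto
  then show "\<exists>l. (k has_real_derivative l) (at z) \<and> 0 < l" using k k'_pos by blast
qed

lemma k_inj: "inj_on k {-\<delta>..\<delta>}"
proof (rule inj_onI)
  fix x y assume xy: "x \<in> {-\<delta>..\<delta>}" "y \<in> {-\<delta>..\<delta>}" "k x = k y"
  then show "x = y" using k_mono[of x y] k_mono[of y x] \<delta> by fastforce
qed

lemma k_cont: "continuous_on {-\<delta>..\<delta>} k"
proof (rule DERIV_continuous_on)
  fix x assume "x \<in> {-\<delta>..\<delta>}"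
  then have "x \<in> {-D<..<D}" using \<delta> by auto
  then show "(k has_real_derivative k' x) (at x within {-\<delta>..\<delta>})"
    by (rule has_field_derivative_at_within[OF k])
qed

lemma R_pos: "0 < R"
proof -
  have "k 0 = 0" using k_eq[of 0] D by simp
  then show ?thesis using k_mono[of 0 \<delta>] k_mono[of "-\<delta>" 0] \<delta> D by (auto simp: R_def)
qed

lemma \<psi>_inverse: "\<psi> u \<in> {-\<delta><..<\<delta>}" "k (\<psi> u) = u" if "u \<in> {-R<..<R}" for u
proof -
  have "\<exists>x\<ge>-\<delta>. x \<le> \<delta> \<and> k x = u"
    using that \<delta> by (intro IVT) (auto simp: R_def intro!: DERIV_isCont[OF k])
  then have "u \<in> k ` {-\<delta>..\<delta>}" by auto
  then have *: "\<psi> u \<in> {-\<delta>..\<delta>}" "k (\<psi> u) = u"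
    using k_inj by (auto simp: \<psi>_def the_inv_into_f_f)
  moreover have "\<psi> u \<noteq> \<delta>" "\<psi> u \<noteq> -\<delta>" using *(2) that by (auto simp: R_def)
  ultimately show "\<psi> u \<in> {-\<delta><..<\<delta>}" "k (\<psi> u) = u" by auto
qed

lemma \<psi>_k: "\<psi> (k x) = x" if "x \<in> {-\<delta>..\<delta>}"
  using that k_inj by (auto simp: \<psi>_def the_inv_into_f_f)

lemma \<psi>_C1: "C1_on \<psi> {-R<..<R}"
proof (rule C1_onI)
  have sub: "{-R<..<R} \<subseteq> k ` {-\<delta>..\<delta>}"
  proof
    fix u assume "u \<in> {-R<..<R}"
    then show "u \<in> k ` {-\<delta>..\<delta>}" using \<psi>_inverse[of u] by (intro image_eqI[of _ _ "\<psi> u"]) auto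
  qed
  have "continuous_on (k ` {-\<delta>..\<delta>}) \<psi>"
    unfolding \<psi>_def by (intro continuous_on_inv_into k_cont k_inj) auto
  then have c: "continuous_on {-R<..<R} \<psi>" using sub by (rule continuous_on_subset)
  have in_D: "\<psi> u \<in> {-D<..<D}" if "u \<in> {-R<..<R}" for u using \<psi>_inverse(1)[OF that] \<delta> by auto
  show "(\<psi> has_real_derivative inverse (k' (\<psi> u))) (at u)" if u: "u \<in> {-R<..<R}" for u
  proof (rule DERIV_inverse_function[where f = k and a = "-R" and b = R])
    show "(k has_real_derivative k' (\<psi> u)) (at (\<psi> u))" using k in_D u by blast
    show "k' (\<psi> u) \<noteq> 0" using k'_pos[OF in_D[OF u]] by simp
    show "isCont \<psi> u" using c u by (auto simp: continuous_on_eq_continuous_at)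
  qed (use u \<psi>_inverse in auto)
  show "continuous_on {-R<..<R} (\<lambda>u. inverse (k' (\<psi> u)))"
  proof (intro continuous_intros continuous_on_compose2[OF C1_on_imp_continuous_on[OF k'_C1] c])
    show "\<forall>u\<in>{-R<..<R}. k' (\<psi> u) \<noteq> 0" using k'_pos in_D by force
  qed (use in_D in auto)
qed

text \<open>
  A level curve need not lie near the origin. If it surrounds the origin, however, it meets the
  line \<open>x = 0\<close>, and it cannot cross \<open>x = \<plusminus>\<delta>\<close>, where \<open>B\<close> exceeds the level and \<open>A\<close> is positive.
\<close>

lemma level_curve_confined:
  fixes \<gamma> :: "real \<Rightarrow> real \<times> real"
  assumes c: "continuous_on UNIV \<gamma>"
    and level: "range \<gamma> \<subseteq> {(x, y). A x * y\<^sup>2 + B x = r\<^sup>2}"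
    and origin: "(0, 0) \<in> inside (range \<gamma>)" and r: "0 < r" "r < R"
  shows "fst (\<gamma> t) \<in> {-\<delta><..<\<delta>}"
proof -
  \<comment> \<open>Otherwise the whole line \<open>x = 0\<close> is a connected subset of the
    complement through the origin, hence contained in the component of the origin, which is bounded
    because the origin is inside the orbit.\<close>
  have "\<exists>t. fst (\<gamma> t) = 0"
  proof (rule ccontr)
    assume "\<not> (\<exists>t. fst (\<gamma> t) = 0)"
    then have "z \<notin> range \<gamma>" if "fst z = 0" for z using that by blast
    then have "{0} \<times> UNIV \<subseteq> - range \<gamma>" by (metis ComplI mem_Times_iff singletonD subsetI)
    moreover have "connected ({0 :: real} \<times> (UNIV :: real set))"
      by (intro connected_Times) auto
    ultimately have "{0} \<times> UNIV \<subseteq> connected_component_set (- range \<gamma>) (0::real, 0::real)"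
      by (intro connected_component_maximal) auto
    then have "bounded ({0::real} \<times> (UNIV :: real set))"
      using origin bounded_subset unfolding inside_def by blast
    then have "bounded (snd ` ({0::real} \<times> (UNIV :: real set)))" by (rule bounded_snd)
    then show False by (simp add: snd_image_times)
  qed
  then obtain t0 where t0: "fst (\<gamma> t0) = 0" ..
  have "connected (range (\<lambda>t. fst (\<gamma> t)))"
    using c by (intro connected_continuous_image continuous_intros) auto
  then have int: "is_interval (range (\<lambda>t. fst (\<gamma> t)))" by (simp add: is_interval_connected_1)
  have off: "e \<notin> range (\<lambda>t. fst (\<gamma> t))" if e: "e = \<delta> \<or> e = -\<delta>" for e
  proof
    assume "e \<in> range (\<lambda>t. fst (\<gamma> t))"
    then obtain t where t: "e = fst (\<gamma> t)" by auto
    have eD: "e \<in> {-D<..<D}" using e \<delta> by auto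
    have "R \<le> \<bar>k e\<bar>" using e by (auto simp: R_def)
    then have "\<bar>r\<bar> < \<bar>k e\<bar>" using r by simp
    then have "r\<^sup>2 < (k e)\<^sup>2" by (rule power2_strict_mono)
    moreover have "\<gamma> t \<in> {(x, y). A x * y\<^sup>2 + B x = r\<^sup>2}"
      by (rule subsetD[OF level rangeI])
    then have "A e * (snd (\<gamma> t))\<^sup>2 + (k e)\<^sup>2 = r\<^sup>2"
      by (simp add: split_beta B[OF eD] flip: t)
    ultimately show False using A_pos[OF eD] by (smt (verit) mult_nonneg_nonneg zero_le_power2)
  qed
  have "0 \<in> range (\<lambda>t. fst (\<gamma> t))" using t0 by (metis rangeI)
  then show ?thesis
    using off[of \<delta>] off[of "-\<delta>"] \<delta>
      mem_is_interval_1_I[OF int, of 0 "fst (\<gamma> t)" \<delta>] mem_is_interval_1_I[OF int, of "fst (\<gamma> t)" 0 "-\<delta>"]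
    by (auto simp: not_le intro!: leI)
qed

text \<open>In \<open>u = k x\<close> and \<open>v = sqrt (A x) * y\<close> the Hamiltonian system
  reads \<open>u' = w x * v\<close>, \<open>v' = - w x * u\<close>. On a fixed level
  \<open>x\<close> depends on the angle alone, so the angle obeys an autonomous equation.\<close>

lemma orbit_parametrization:
  assumes per: "periodic_solution I (\<lambda>x y. A x * y\<^sup>2 + B x) \<gamma> T"
    and level: "range \<gamma> \<subseteq> {(x, y). A x * y\<^sup>2 + B x = r\<^sup>2}"
    and origin: "(0, 0) \<in> inside (range \<gamma>)" and r: "0 < r" "r < R"
  obtains \<theta> where "\<And>t. (\<theta> has_real_derivative w (\<psi> (r * sin (\<theta> t)))) (at t)"
    and "\<And>t. fst (\<gamma> t) = \<psi> (r * sin (\<theta> t))"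
    and "\<And>t. snd (\<gamma> t) = r * cos (\<theta> t) / sqrt (A (\<psi> (r * sin (\<theta> t))))"
    and "\<And>t. deriv (\<lambda>s. fst (\<gamma> s)) t = 2 * A (fst (\<gamma> t)) * snd (\<gamma> t)"
    and "\<theta> T = \<theta> 0 + 2 * pi"
proof -
  define H where "H = (\<lambda>x y. A x * y\<^sup>2 + B x)"
  define x where "x = (\<lambda>t. fst (\<gamma> t))"
  define y where "y = (\<lambda>t. snd (\<gamma> t))"
  have d\<gamma>: "(\<gamma> has_vector_derivative hamiltonian_field H (\<gamma> t)) (at t)" for t
    using per by (auto simp: periodic_solution_def H_def)
  have T: "0 < T" and \<gamma>T: "\<gamma> (t + T) = \<gamma> t" for t
    using per by (auto simp: periodic_solution_def)
  have c\<gamma>: "continuous_on UNIV \<gamma>"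
    using d\<gamma> by (auto simp: continuous_on_eq_continuous_at intro: has_vector_derivative_continuous)
  have x\<delta>: "x t \<in> {-\<delta><..<\<delta>}" for t
    unfolding x_def by (rule level_curve_confined[OF c\<gamma> level origin r])
  then have xD: "x t \<in> {-D<..<D}" for t using \<delta> by (smt (verit) greaterThanLessThan_iff)
  have lev: "A (x t) * (y t)\<^sup>2 + (k (x t))\<^sup>2 = r\<^sup>2" for t
    using level B[OF xD] by (auto simp: x_def y_def image_subset_iff split_beta)
  have H1: "fst (hamiltonian_field H (\<gamma> t)) = 2 * A (x t) * y t" for t
    unfolding hamiltonian_field_def H_def x_def y_def fst_conv
    by (intro DERIV_imp_deriv) (auto intro!: derivative_eq_intros)
  have H2: "snd (hamiltonian_field H (\<gamma> t)) = - (A' (x t) * (y t)\<^sup>2 + 2 * k (x t) * k' (x t))" for t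
  proof -
    have "((\<lambda>z. (k z)\<^sup>2) has_real_derivative 2 * k (x t) * k' (x t)) (at (x t))"
      by (auto intro!: derivative_eq_intros k[OF xD])
    then have "(B has_real_derivative 2 * k (x t) * k' (x t)) (at (x t))"
      by (rule has_field_derivative_transform_within_open[where S = "{-D<..<D}"]) (use xD B in auto)
    then have "((\<lambda>z. A z * (y t)\<^sup>2 + B z) has_real_derivative
        A' (x t) * (y t)\<^sup>2 + 2 * k (x t) * k' (x t)) (at (x t))"
      by (auto intro!: derivative_eq_intros A[OF xD])
    then show ?thesis
      by (simp add: hamiltonian_field_def H_def x_def y_def DERIV_imp_deriv)
  qed
  have dx: "(x has_real_derivative 2 * A (x t) * y t) (at t)" for t
    using bounded_linear.has_vector_derivative[OF bounded_linear_fst d\<gamma>]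
    unfolding x_def[symmetric] H1 by (simp add: has_real_derivative_iff_has_vector_derivative)
  have dy: "(y has_real_derivative - (A' (x t) * (y t)\<^sup>2 + 2 * k (x t) * k' (x t))) (at t)" for t
    using bounded_linear.has_vector_derivative[OF bounded_linear_snd d\<gamma>]
    unfolding y_def[symmetric] H2 by (simp add: has_real_derivative_iff_has_vector_derivative)
  define u where "u = (\<lambda>t. k (x t))"
  define v where "v = (\<lambda>t. sqrt (A (x t)) * y t)"
  have Ap: "0 < A (x t)" for t by (rule A_pos[OF xD])
  have sq: "sqrt (A (x t)) * sqrt (A (x t)) = A (x t)" for t using Ap[of t] by simp
  have du: "(u has_real_derivative w (x t) * v t) (at t)" for t
  proof -
    have "(u has_real_derivative k' (x t) * (2 * A (x t) * y t)) (at t)"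
      unfolding u_def by (rule DERIV_chain2[where f = k]) (rule k[OF xD] dx)+
    also have "k' (x t) * (2 * A (x t) * y t) = k' (x t) * (2 * (sqrt (A (x t)) * sqrt (A (x t))) * y t)"
      by (simp only: sq)
    also have "\<dots> = w (x t) * v t" by (simp add: w_def v_def)
    finally show ?thesis .
  qed
  have dv: "(v has_real_derivative - (w (x t) * u t)) (at t)" for t
  proof -
    have "((\<lambda>t. A (x t)) has_real_derivative A' (x t) * (2 * A (x t) * y t)) (at t)"
      by (rule DERIV_chain2[where f = A]) (rule A[OF xD] dx)+
    then have "((\<lambda>t. sqrt (A (x t))) has_real_derivative
        inverse (sqrt (A (x t))) / 2 * (A' (x t) * (2 * A (x t) * y t))) (at t)"
      by (intro DERIV_chain2[where f = sqrt] DERIV_real_sqrt Ap)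
    from DERIV_mult[OF this dy] have "(v has_real_derivative
        inverse (sqrt (A (x t))) / 2 * (A' (x t) * (2 * A (x t) * y t)) * y t +
        - (A' (x t) * (y t)\<^sup>2 + 2 * k (x t) * k' (x t)) * sqrt (A (x t))) (at t)"
      unfolding v_def .
    \<comment> \<open>The contribution of the varying factor \<open>sqrt (A x)\<close> cancels the
      \<open>A'\<close> term of \<open>dy\<close>; what remains is a pure rotation.\<close>
    also have "inverse (sqrt (A (x t))) / 2 * (A' (x t) * (2 * A (x t) * y t)) * y t =
        A' (x t) * sqrt (A (x t)) * (y t)\<^sup>2"
      using Ap[of t] sq[of t] by (simp add: field_simps power2_eq_square)
    finally show ?thesis by (simp add: w_def u_def algebra_simps)
  qed
  have cw: "continuous_on {-D<..<D} w"
    unfolding w_def using k'_C1 A_C1 by (intro continuous_intros C1_on_imp_continuous_on)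
  have cx: "continuous_on UNIV x"
    using dx by (intro DERIV_continuous_on) auto
  have c\<omega>: "continuous_on UNIV (\<lambda>t. w (x t))"
    by (rule continuous_on_compose2[OF cw cx]) (use xD in auto)
  have circ: "(u t)\<^sup>2 + (v t)\<^sup>2 = r\<^sup>2" for t
    using lev[of t] Ap[of t] by (simp add: u_def v_def power_mult_distrib)
  obtain \<theta> where \<theta>: "\<And>t. (\<theta> has_real_derivative w (x t)) (at t)"
    and u: "\<And>t. u t = r * sin (\<theta> t)" and v: "\<And>t. v t = r * cos (\<theta> t)"
    using rotation_polar_angle[OF c\<omega> du dv circ r(1)] by blast
  have x: "x t = \<psi> (r * sin (\<theta> t))" for t
    using \<psi>_k[of "x t"] x\<delta>[of t] u[of t] by (simp add: u_def)
  have y: "y t = r * cos (\<theta> t) / sqrt (A (\<psi> (r * sin (\<theta> t))))" for t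
    using v[of t] Ap[of t] by (simp add: v_def field_simps flip: x)
  have in_R: "r * sin z \<in> {-R<..<R}" for z
  proof -
    have "\<bar>r * sin z\<bar> \<le> r * 1" unfolding abs_mult using r by (intro mult_mono) auto
    then show ?thesis using r by auto
  qed
  define W where "W = (\<lambda>z. w (\<psi> (r * sin z)))"
  have in_D: "\<psi> (r * sin z) \<in> {-D<..<D}" for z using \<psi>_inverse(1)[OF in_R[of z]] \<delta> by auto
  have W_cont: "continuous_on UNIV W"
    unfolding W_def
    by (intro continuous_on_compose2[OF cw] continuous_on_compose2[OF C1_on_imp_continuous_on[OF \<psi>_C1]]
        continuous_intros) (use in_R in_D in auto)
  have W_pos: "0 < W z" for z
    using k'_pos[OF in_D] A_pos[OF in_D] by (simp add: W_def w_def)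
  have W_per: "W (z + 2 * pi) = W z" for z by (simp add: W_def)
  have \<theta>W: "(\<theta> has_real_derivative W (\<theta> t)) (at t)" for t
    using \<theta>[of t] by (simp add: W_def flip: x)
  have \<gamma>_eq: "\<gamma> t = (\<psi> (r * sin (\<theta> t)), r * cos (\<theta> t) / sqrt (A (\<psi> (r * sin (\<theta> t)))))" for t
    using x[of t] y[of t] by (simp add: x_def y_def prod_eq_iff)
  have "\<theta> 0 < \<theta> T"
  proof (rule DERIV_pos_imp_increasing[OF T])
    fix t
    show "\<exists>l. (\<theta> has_real_derivative l) (at t) \<and> 0 < l"
      using \<theta>W[of t] W_pos[of "\<theta> t"] by (intro exI conjI)
  qed
  moreover have "sin (\<theta> T) = sin (\<theta> 0) \<and> cos (\<theta> T) = cos (\<theta> 0)"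
  proof -
    have "u T = u 0" "v T = v 0" using \<gamma>T[of 0] by (auto simp: u_def v_def x_def y_def)
    then show ?thesis using u v r by auto
  qed
  then obtain n :: int where n: "\<theta> T = \<theta> 0 + 2 * pi * n" unfolding sin_cos_eq_iff by auto
  ultimately have "0 < n" by (simp add: zero_less_mult_iff)
  then have "2 * pi * 1 \<le> 2 * pi * n" by (intro mult_left_mono) auto
  \<comment> \<open>After the period \<open>T\<close> the angle has advanced by
    \<open>n \<ge> 1\<close> full turns. The time \<open>t1\<close> at which one turn is complete is
    itself a period, so minimality gives \<open>t1 = T\<close> and excludes
    \<open>n > 1\<close>.\<close>
  then have "\<exists>t\<ge>0. t \<le> T \<and> \<theta> t = \<theta> 0 + 2 * pi"
    using n T \<theta> by (intro IVT) (auto intro: DERIV_isCont)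
  then obtain t1 where t1: "0 \<le> t1" "t1 \<le> T" "\<theta> t1 = \<theta> 0 + 2 * pi" by blast
  have "\<gamma> (t + t1) = \<gamma> t" for t
  proof -
    have "\<theta> (t + t1) = \<theta> t + 2 * pi"
      by (rule autonomous_angle_shift[OF \<theta>W W_cont W_pos W_per t1(3)])
    then show ?thesis unfolding \<gamma>_eq by simp
  qed
  moreover have "0 < t1" using t1 by (cases "t1 = 0") auto
  ultimately have "t1 = T" using per t1 by (auto simp: periodic_solution_def)
  moreover have "deriv (\<lambda>s. fst (\<gamma> s)) t = 2 * A (fst (\<gamma> t)) * snd (\<gamma> t)" for t
    using DERIV_imp_deriv[OF dx[of t]] by (simp add: x_def y_def)
  ultimately show ?thesis
    using that[of \<theta>] \<theta>W x y t1 by (simp add: W_def x_def y_def)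
qed

text \<open>With \<open>u = x * s x\<close> and \<open>v = sqrt (A x) * y\<close>, the form \<open>x ^ (2 * q) * y ^ (2 * p - 1) dx\<close> restricted to
  an orbit is \<open>u ^ (2 * q) * v ^ (2 * p) * g q p u d\<theta>\<close>.\<close>

definition g :: "nat \<Rightarrow> nat \<Rightarrow> real \<Rightarrow> real" where
  "g q p u = sqrt (A (\<psi> u)) / (s (\<psi> u) ^ (2 * q) * A (\<psi> u) ^ p * k' (\<psi> u))"

definition K :: "nat \<Rightarrow> nat \<Rightarrow> real \<Rightarrow> real" where
  "K q p r = integral {-pi..pi} (\<lambda>\<theta>. sin \<theta> ^ (2 * q) * cos \<theta> ^ (2 * p) * g q p (r * sin \<theta>))"

text \<open>All factors are regular and positive near \<open>0\<close>. Since \<open>k'\<close>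
  occurs in \<open>g q p\<close>, the chart has to provide a continuously differentiable
  \<open>k'\<close>, that is, two derivatives of \<open>k\<close>.\<close>

lemma
  shows g_C1: "C1_on (g q p) {-R<..<R}" and g_pos: "u \<in> {-R<..<R} \<Longrightarrow> 0 < g q p u"
proof -
  have in_D: "\<psi> u \<in> {-D<..<D}" if "u \<in> {-R<..<R}" for u using \<psi>_inverse(1)[OF that] \<delta> by auto
  have pos: "0 < A (\<psi> u)" "0 < s (\<psi> u)" "0 < k' (\<psi> u)" if "u \<in> {-R<..<R}" for u
    using A_pos s_pos k'_pos in_D[OF that] by auto
  show "0 < g q p u" if "u \<in> {-R<..<R}" using pos[OF that] by (simp add: g_def)
  have "C1_on (\<lambda>u. A (\<psi> u)) {-R<..<R}" "C1_on (\<lambda>u. s (\<psi> u)) {-R<..<R}" "C1_on (\<lambda>u. k' (\<psi> u)) {-R<..<R}"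
    using in_D by (auto intro!: C1_on_compose[OF _ \<psi>_C1] A_C1 s_C1 k'_C1)
  then show "C1_on (g q p) {-R<..<R}"
    unfolding g_def using pos by (intro C1_intros) (auto simp: less_imp_neq[symmetric])
qed

lemma
  shows K_C1: "C1_on (K q p) {-R<..<R}" and K_pos: "0 < K q p 0"
proof -
  obtain g' where g': "(\<forall>u\<in>{-R<..<R}. (g q p has_real_derivative g' u) (at u)) \<and>
      continuous_on {-R<..<R} g'"
    using g_C1[of q p] unfolding C1_on_def by (rule exE)
  note moment = trig_moment_integral[OF R_pos, where g = "g q p" and g' = g' and q = q and p = p]
  show "C1_on (K q p) {-R<..<R}"
    unfolding K_def using g' by (intro C1_onI[OF moment(1) moment(2)]) simp_all
  show "0 < K q p 0"
    unfolding K_def using g' g_pos[of 0] R_pos by (intro moment(3)) simp_all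
qed

text \<open>The derivative of \<open>x\<close> along the flow is \<open>2 * A x * y\<close>; its
  factor \<open>y\<close> turns the exponent \<open>2 * p - 1\<close> into \<open>2 * p\<close>. The
  radius then factors out as \<open>r ^ (2 * (q + p))\<close>, which is the integer power
  \<open>h ^ (q + p)\<close>.\<close>

lemma abelian_monomial:
  assumes per: "periodic_solution I (\<lambda>x y. A x * y\<^sup>2 + B x) \<gamma> T"
    and level: "range \<gamma> \<subseteq> {(x, y). A x * y\<^sup>2 + B x = h}"
    and origin: "(0, 0) \<in> inside (range \<gamma>)" and h: "0 < h" "h < R\<^sup>2" and p: "1 \<le> p"
  shows "((\<lambda>t. fst (\<gamma> t) ^ (2 * q) * snd (\<gamma> t) ^ (2 * p - 1) * deriv (\<lambda>s. fst (\<gamma> s)) t)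
    has_integral h ^ (q + p) * K q p (sqrt h)) {0..T}"
proof -
  define r where "r = sqrt h"
  have r: "0 < r" "r < R" "r\<^sup>2 = h" using h R_pos by (auto simp: r_def real_less_lsqrt)
  obtain \<theta> where \<theta>: "\<And>t. (\<theta> has_real_derivative w (\<psi> (r * sin (\<theta> t)))) (at t)"
    and x: "\<And>t. fst (\<gamma> t) = \<psi> (r * sin (\<theta> t))"
    and y: "\<And>t. snd (\<gamma> t) = r * cos (\<theta> t) / sqrt (A (\<psi> (r * sin (\<theta> t))))"
    and x': "\<And>t. deriv (\<lambda>s. fst (\<gamma> s)) t = 2 * A (fst (\<gamma> t)) * snd (\<gamma> t)"
    and \<theta>T: "\<theta> T = \<theta> 0 + 2 * pi"
    using orbit_parametrization[OF per level[folded r(3)] origin r(1,2)] by blast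
  have in_R: "r * sin z \<in> {-R<..<R}" for z
  proof -
    have "\<bar>r * sin z\<bar> \<le> r * 1" unfolding abs_mult using r by (intro mult_mono) auto
    then show ?thesis using r by auto
  qed
  define f where "f z = r ^ (2 * (q + p)) * (sin z ^ (2 * q) * cos z ^ (2 * p) * g q p (r * sin z))" for z
  have cont: "continuous_on UNIV f"
    unfolding f_def
    by (intro continuous_intros continuous_on_compose2[OF C1_on_imp_continuous_on[OF g_C1]])
      (use in_R in auto)
  have "((\<lambda>t. f (\<theta> t) * w (\<psi> (r * sin (\<theta> t)))) has_integral integral {-pi..pi} f) {0..T}"
    using per \<theta>T by (intro integral_over_period \<theta> cont)
      (auto simp: f_def periodic_solution_def)
  moreover have "integral {-pi..pi} f = r ^ (2 * (q + p)) * K q p r"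
    unfolding f_def K_def by simp
  then have "integral {-pi..pi} f = h ^ (q + p) * K q p (sqrt h)"
    unfolding power_mult r(3) by (simp only: r_def)
  moreover have "f (\<theta> t) * w (\<psi> (r * sin (\<theta> t))) =
      fst (\<gamma> t) ^ (2 * q) * snd (\<gamma> t) ^ (2 * p - 1) * deriv (\<lambda>s. fst (\<gamma> s)) t" for t
  proof -
    define X where "X = \<psi> (r * sin (\<theta> t))"
    define Y where "Y = snd (\<gamma> t)"
    define a where "a = sqrt (A X)"
    have XD: "X \<in> {-D<..<D}" using \<psi>_inverse(1)[OF in_R[of "\<theta> t"]] \<delta> by (simp add: X_def)
    have pos: "0 < a" "0 < s X" "0 < k' X" "A X = a * a"
      using A_pos[OF XD] s_pos[OF XD] k'_pos[OF XD] by (auto simp: a_def)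
    have 1: "r * sin (\<theta> t) = X * s X"
      using \<psi>_inverse(2)[OF in_R[of "\<theta> t"]] k_eq[OF XD] by (simp add: X_def)
    have 2: "r * cos (\<theta> t) = a * Y" using y[of t] pos by (simp add: Y_def a_def X_def)
    have "f (\<theta> t) = (r * sin (\<theta> t)) ^ (2 * q) * (r * cos (\<theta> t)) ^ (2 * p) * g q p (r * sin (\<theta> t))"
      by (simp add: f_def power_mult_distrib power_add algebra_simps)
    also have "\<dots> = (X * s X) ^ (2 * q) * (a * Y) ^ (2 * p) * (a / (s X ^ (2 * q) * A X ^ p * k' X))"
      unfolding 2 by (simp add: g_def a_def flip: X_def) (simp add: 1)
    also have "A X ^ p = a ^ (2 * p)" by (simp add: pos(4) power_mult power2_eq_square)
    finally have "f (\<theta> t) = X ^ (2 * q) * Y ^ (2 * p) * a / k' X"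
      using pos by (simp add: power_mult_distrib)
    \<comment> \<open>Here \<open>1 \<le> p\<close> matters: \<open>2 * p - 1\<close> is a
      subtraction of natural numbers.\<close>
    moreover have "Y ^ (2 * p) = Y ^ (2 * p - 1) * Y" using p by (simp flip: power_Suc2)
    moreover have "w X = 2 * k' X * a" by (simp add: w_def a_def)
    ultimately have "f (\<theta> t) * w X = X ^ (2 * q) * Y ^ (2 * p - 1) * (2 * A X * Y)"
      using pos by simp
    then show ?thesis unfolding x' by (simp add: x flip: X_def Y_def)
  qed
  ultimately show ?thesis by simp
qed

lemma abelian_integral_eq:
  assumes per: "periodic_solution I (\<lambda>x y. A x * y\<^sup>2 + B x) (\<gamma> h) (T h)"
    and level: "range (\<gamma> h) \<subseteq> {(x, y). A x * y\<^sup>2 + B x = h}"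
    and origin: "(0, 0) \<in> inside (range (\<gamma> h))" and h: "0 < h" "h < R\<^sup>2"
    and p: "\<And>j. j \<le> l \<Longrightarrow> 1 \<le> p j"
  shows "abelian_integral l q p d \<gamma> T h =
    (\<Sum>j=0..l. d j * (h ^ (q j + p j) * K (q j) (p j) (sqrt h)))"
proof -
  have "((\<lambda>t. \<Sum>j=0..l. d j * (fst (\<gamma> h t) ^ (2 * q j) * snd (\<gamma> h t) ^ (2 * p j - 1) *
      deriv (\<lambda>s. fst (\<gamma> h s)) t)) has_integral
    (\<Sum>j=0..l. d j * (h ^ (q j + p j) * K (q j) (p j) (sqrt h)))) {0..T h}"
    by (intro has_integral_sum has_integral_mult_right abelian_monomial[OF per level origin h] p) auto
  then show ?thesis
    unfolding abelian_integral_def line_integral_dx_def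
    by (simp add: integral_unique sum_distrib_right mult.assoc)
qed

end

subsection \<open>Existence of circular coordinates\<close>

text \<open>If some coefficient below \<open>N\<close> were nonzero, let \<open>k < N\<close> be the
  subdegree: \<open>f x / x ^ k\<close> tends to the nonzero coefficient \<open>k\<close>, while the
  bound by a multiple of \<open>\<bar>x\<bar> ^ (N - k)\<close> forces the limit
  \<open>0\<close>.\<close>

lemma fps_coeff_eq_0_if_bigo:
  fixes f :: "real \<Rightarrow> real"
  assumes "f has_fps_expansion F" "f \<in> O[nhds 0](\<lambda>x. x ^ N)" "n < N"
  shows "fps_nth F n = 0"
proof (rule ccontr)
  assume nz: "fps_nth F n \<noteq> 0"
  define k where "k = subdegree F"
  have "k \<le> n" unfolding k_def using nz by (rule subdegree_leI)
  with assms(3) have "k < N" by simp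
  have "(\<lambda>x. if x = 0 then fps_nth F k else f x / x ^ k) has_fps_expansion fps_shift k F"
    using assms(1) by (rule has_fps_expansion_shift) (simp_all add: k_def)
  then have "((\<lambda>x. if x = 0 then fps_nth F k else f x / x ^ k) \<longlongrightarrow> fps_nth F k) (at 0)"
    by (auto dest: has_fps_expansion_imp_continuous[where A = UNIV] simp: isCont_def)
  then have L: "((\<lambda>x. f x / x ^ k) \<longlongrightarrow> fps_nth F k) (at 0)"
    by (rule Lim_transform_eventually) (simp add: eventually_at_filter)
  obtain c where "\<forall>\<^sub>F x in nhds 0. norm (f x) \<le> c * norm (x ^ N)"
    using assms(2) by (rule landau_o.bigE)
  then have le: "\<forall>\<^sub>F x in at 0. norm (f x / x ^ k) \<le> c * \<bar>x\<bar> ^ (N - k)"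
    unfolding eventually_at_filter
  proof eventually_elim
    case (elim x)
    have "\<bar>x\<bar> ^ N = \<bar>x\<bar> ^ (N - k) * \<bar>x\<bar> ^ k" using \<open>k < N\<close> by (simp flip: power_add)
    then show ?case using elim by (simp add: abs_divide power_abs divide_le_eq)
  qed
  have "((\<lambda>x. c * \<bar>x\<bar> ^ (N - k)) \<longlongrightarrow> c * \<bar>0\<bar> ^ (N - k)) (at (0::real))"
    by (intro tendsto_intros)
  moreover have "(0::real) ^ (N - k) = 0" using \<open>k < N\<close> by simp
  ultimately have "((\<lambda>x. c * \<bar>x\<bar> ^ (N - k)) \<longlongrightarrow> 0) (at (0::real))" by simp
  with le have "((\<lambda>x. f x / x ^ k) \<longlongrightarrow> 0) (at 0)" by (rule Lim_null_comparison)
  with L have "fps_nth F k = 0" using tendsto_unique trivial_limit_at by blast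
  moreover have "F \<noteq> 0" using nz by auto
  ultimately show False by (simp add: k_def)
qed

lemma eval_fps_C1_on:
  fixes F :: "real fps"
  assumes "\<And>x. x \<in> U \<Longrightarrow> ereal \<bar>x\<bar> < fps_conv_radius F"
  shows "\<And>x. x \<in> U \<Longrightarrow> (eval_fps F has_real_derivative eval_fps (fps_deriv F) x) (at x)"
    and "continuous_on U (eval_fps (fps_deriv F))" and "C1_on (eval_fps F) U"
proof -
  show 1: "(eval_fps F has_real_derivative eval_fps (fps_deriv F) x) (at x)" if "x \<in> U" for x
    using assms[OF that] by (intro has_field_derivative_eval_fps) simp
  have "ereal \<bar>x\<bar> < fps_conv_radius (fps_deriv F)" if "x \<in> U" for x
    using assms[OF that] fps_conv_radius_deriv[of F] by (rule less_le_trans)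
  then show 2: "continuous_on U (eval_fps (fps_deriv F))"
    by (intro continuous_on_subset[OF continuous_on_eval_fps]) (auto simp: dist_real_def)
  show "C1_on (eval_fps F) U" using 1 2 by (rule C1_onI)
qed

text \<open>The expansion of \<open>B\<close> starts with \<open>x ^ 2 / b ^ 2\<close>, so
  \<open>B x = x ^ 2 * \<beta> x\<close> with \<open>\<beta>\<close> a power series and
  \<open>\<beta> 0 = 1 / b ^ 2 > 0\<close>. Taking \<open>s = sqrt \<beta>\<close> and
  \<open>k x = x * s x\<close> gives a root of \<open>B\<close> that is smooth through
  \<open>0\<close>, unlike \<open>sqrt (B x)\<close>, which behaves like
  \<open>\<bar>x\<bar>\<close>.\<close>

lemma center_has_circular_chart:
  fixes A B :: "real \<Rightarrow> real"
  assumes F: "A has_fps_expansion F" and G: "B has_fps_expansion G" and ab: "a \<noteq> 0" "b \<noteq> 0"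
    and OA: "(\<lambda>x. A x - a ^ 2) \<in> O[nhds 0](\<lambda>x. x)"
    and OB: "(\<lambda>x. B x - x ^ 2 / b ^ 2) \<in> O[nhds 0](\<lambda>x. x ^ 3)"
  obtains A' k k' s D where "circular_chart A A' B k k' s D"
proof -
  have "(\<lambda>x. B x - 1 / b ^ 2 * x ^ 2) has_fps_expansion G - fps_const (1 / b ^ 2) * fps_X ^ 2"
    by (intro fps_expansion_intros G)
  from fps_coeff_eq_0_if_bigo[OF this] OB
  have "fps_nth (G - fps_const (1 / b ^ 2) * fps_X ^ 2) n = 0" if "n < 3" for n
    using that by simp
  from this[of 0] this[of 1] this[of 2]
  have G012: "fps_nth G 0 = 0" "fps_nth G 1 = 0" "fps_nth G 2 = 1 / b ^ 2" by simp_all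
  then have sub: "2 \<le> subdegree G"
    using ab by (intro subdegree_geI) (auto simp: less_2_cases_iff)
  \<comment> \<open>The filter \<open>nhds 0\<close> includes the point \<open>0\<close> itself,
    where the bound reads \<open>norm (A 0 - a ^ 2) \<le> 0\<close>.\<close>
  have "\<forall>\<^sub>F x in nhds 0. A x - a ^ 2 = 0 \<or> x \<noteq> 0"
  proof -
    obtain c where "\<forall>\<^sub>F x in nhds 0. norm (A x - a ^ 2) \<le> c * norm x"
      using OA by (rule landau_o.bigE)
    then show ?thesis by eventually_elim auto
  qed
  then have A0: "A 0 = a ^ 2" using eventually_nhds_x_imp_x by force
  define P where "P = fps_shift 2 G"
  define \<beta> where "\<beta> = eval_fps P"
  define \<beta>' where "\<beta>' = eval_fps (fps_deriv P)"
  have conv: "0 < fps_conv_radius F" "0 < fps_conv_radius P"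
    using F G by (auto simp: has_fps_expansion_def P_def)
  have \<beta>0: "\<beta> 0 = 1 / b ^ 2" using G012(3) by (simp add: \<beta>_def P_def eval_fps_at_0 flip: numeral_2_eq_2)
  have near: "\<forall>\<^sub>F x in nhds 0. ereal \<bar>x\<bar> < c" if "0 < c" for c
  proof -
    have "\<forall>\<^sub>F x in nhds 0. x \<in> eball (0::real) c"
      using that by (intro eventually_nhds_in_open) (auto simp: zero_ereal_def)
    then show ?thesis by (simp add: dist_real_def)
  qed
  have "\<forall>\<^sub>F x in nhds 0. A x = eval_fps F x" "\<forall>\<^sub>F x in nhds 0. B x = eval_fps G x"
    using F G by (auto simp: has_fps_expansion_def elim: eventually_mono)
  with near[OF conv(1)] near[OF conv(2)]
  have "\<forall>\<^sub>F x in nhds 0. A x = eval_fps F x \<and> B x = x ^ 2 * \<beta> x \<and>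
      ereal \<bar>x\<bar> < fps_conv_radius F \<and> ereal \<bar>x\<bar> < fps_conv_radius P"
  proof eventually_elim
    case (elim x)
    have "\<beta> x = (if x = 0 then fps_nth G 2 else eval_fps G x / x ^ 2)"
      unfolding \<beta>_def P_def using elim by (intro eval_fps_shift sub) (simp add: P_def)
    then show ?case using elim by (auto simp: eval_fps_at_0 G012)
  qed
  then obtain r where r: "0 < r" and U: "\<And>x. x \<in> {-r<..<r} \<Longrightarrow> A x = eval_fps F x \<and> B x = x ^ 2 * \<beta> x \<and>
      ereal \<bar>x\<bar> < fps_conv_radius F \<and> ereal \<bar>x\<bar> < fps_conv_radius P"
    by (auto simp: eventually_nhds_metric dist_real_def abs_less_iff)
  have UF: "ereal \<bar>x\<bar> < fps_conv_radius F" and UP: "ereal \<bar>x\<bar> < fps_conv_radius P"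
    and UP': "ereal \<bar>x\<bar> < fps_conv_radius (fps_deriv P)" if "x \<in> {-r<..<r}" for x
    using U[OF that] less_le_trans[OF _ fps_conv_radius_deriv[of P]] by auto
  have \<beta>: "(\<beta> has_real_derivative \<beta>' x) (at x)" if "x \<in> {-r<..<r}" for x
    unfolding \<beta>_def \<beta>'_def by (rule eval_fps_C1_on(1)[OF UP that])
  have \<beta>_C1: "C1_on \<beta> {-r<..<r}" unfolding \<beta>_def by (rule eval_fps_C1_on(3)[OF UP])
  have \<beta>'_C1: "C1_on \<beta>' {-r<..<r}" unfolding \<beta>'_def by (rule eval_fps_C1_on(3)[OF UP'])
  have A: "(A has_real_derivative eval_fps (fps_deriv F) x) (at x)" if "x \<in> {-r<..<r}" for x
    by (rule has_field_derivative_transform_within_open[OF eval_fps_C1_on(1)[OF UF that] open_greaterThanLessThan that])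
      (use U in auto)
  define s where "s = (\<lambda>x. sqrt (\<beta> x))"
  define k' where "k' = (\<lambda>x. s x + x * (\<beta>' x / (2 * s x)))"
  have 0: "0 \<in> {-r<..<r}" using r by simp
  have cont0: "isCont A 0" "isCont \<beta> 0" "isCont \<beta>' 0"
    using DERIV_isCont[OF A[OF 0]] DERIV_isCont[OF \<beta>[OF 0]] C1_on_imp_continuous_on[OF \<beta>'_C1] 0
    by (auto simp: continuous_on_eq_continuous_at)
  have s0: "0 < s 0" using ab by (simp add: s_def \<beta>0)
  have "isCont s 0" unfolding s_def using cont0(2) by (rule continuous_real_sqrt)
  then have cont1: "isCont k' 0"
    unfolding k'_def using cont0 s0 by (intro continuous_intros) auto
  have ev: "\<forall>\<^sub>F x in nhds 0. 0 < f x" if "isCont f 0" "0 < f 0" for f :: "real \<Rightarrow> real"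
    using that by (intro order_tendstoD(1)[of f "f 0"]) (auto simp: isCont_def tendsto_at_iff_tendsto_nhds)
  have "\<forall>\<^sub>F x in nhds 0. 0 < A x \<and> 0 < \<beta> x \<and> 0 < k' x"
    using ab s0 by (intro eventually_conj ev cont0 cont1) (auto simp: A0 \<beta>0 k'_def)
  then obtain e where e: "0 < e" "\<And>x. x \<in> {-e<..<e} \<Longrightarrow> 0 < A x \<and> 0 < \<beta> x \<and> 0 < k' x"
    by (auto simp: eventually_nhds_metric dist_real_def abs_less_iff)
  define D where "D = min r e"
  have Dr: "x \<in> {-r<..<r}" and De: "x \<in> {-e<..<e}" if "x \<in> {-D<..<D}" for x
    using that by (auto simp: D_def)
  have Dsub: "{-D<..<D} \<subseteq> {-r<..<r}" using Dr by blast
  have subset: "C1_on f {-D<..<D}" if "C1_on f {-r<..<r}" for f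
    using that Dr continuous_on_subset[OF _ Dsub] unfolding C1_on_def by meson
  have s_pos: "0 < s x" if "x \<in> {-D<..<D}" for x using e(2)[OF De[OF that]] by (simp add: s_def)
  have s_C1: "C1_on s {-D<..<D}"
    unfolding s_def by (rule C1_on_sqrt[OF subset[OF \<beta>_C1]]) (use e(2) De in blast)
  have k'_C1: "C1_on k' {-D<..<D}"
    unfolding k'_def using s_pos
    by (intro C1_on_add C1_on_mult C1_on_divide C1_on_id C1_on_const s_C1 subset[OF \<beta>'_C1]) force
  have "circular_chart A (eval_fps (fps_deriv F)) B (\<lambda>x. x * s x) k' s D"
  proof
    show "0 < D" using r e by (simp add: D_def)
    fix x assume x: "x \<in> {-D<..<D}"
    have "(s has_real_derivative inverse (sqrt (\<beta> x)) / 2 * \<beta>' x) (at x)"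
      unfolding s_def using e(2)[OF De[OF x]]
      by (intro DERIV_chain2[where f = sqrt] DERIV_real_sqrt \<beta> Dr x) blast
    from DERIV_mult[OF DERIV_ident this]
    show "((\<lambda>x. x * s x) has_real_derivative k' x) (at x)"
      by (rule DERIV_cong) (simp add: k'_def s_def field_simps)
    show "B x = (x * s x)\<^sup>2"
      using U[OF Dr[OF x]] e(2)[OF De[OF x]] by (simp add: s_def power_mult_distrib)
  next
    show "continuous_on {-D<..<D} (eval_fps (fps_deriv F))"
      using eval_fps_C1_on(2)[OF UF] Dsub by (rule continuous_on_subset)
  qed (use A Dr De e(2) s_pos s_C1 k'_C1 in blast)+
  then show ?thesis by (rule that)
qed

theorem theorem3:
  fixes A B :: "real \<Rightarrow> real" and I :: "real set" and a b :: real
    and H :: "real \<Rightarrow> real \<Rightarrow> real" and hbar :: ereal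
    and \<gamma> :: "real \<Rightarrow> real \<Rightarrow> real \<times> real" and T :: "real \<Rightarrow> real"
    and l :: nat and q p :: "nat \<Rightarrow> nat"
  assumes "open I" and "is_interval I" and "0 \<in> I"
    and "real_analytic_on A I" and "real_analytic_on B I"
    and "a * b \<noteq> 0"
    and "(\<lambda>x. A x - a ^ 2) \<in> O[nhds 0](\<lambda>x. x)"
    and "(\<lambda>x. B x - x ^ 2 / b ^ 2) \<in> O[nhds 0](\<lambda>x. x ^ 3)"
    and "H = (\<lambda>x y. A x * y ^ 2 + B x)"
    and "0 < hbar" and "periodic_orbits_around_origin I H hbar \<gamma> T"
    and "1 \<le> l"
    and "\<And>j. j \<le> l \<Longrightarrow> 1 \<le> q j \<and> 1 \<le> p j"
    and "inj_on (\<lambda>j. q j + p j) {0..l}"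
  shows "\<exists>d :: nat \<Rightarrow> real. \<exists>Z. finite Z \<and> card Z = l \<and>
           (\<forall>h\<in>Z. 0 < h \<and> ereal h < hbar \<and> simple_zero (abelian_integral l q p d \<gamma> T) h)"
proof -
  obtain F where "(\<lambda>x. A (0 + x)) has_fps_expansion F"
    using assms(3,4) unfolding real_analytic_on_def by blast
  then have F: "A has_fps_expansion F" by simp
  obtain G where "(\<lambda>x. B (0 + x)) has_fps_expansion G"
    using assms(3,5) unfolding real_analytic_on_def by blast
  then have G: "B has_fps_expansion G" by simp
  have "a \<noteq> 0" "b \<noteq> 0" using assms(6) by auto
  from center_has_circular_chart[OF F G this assms(7,8)]
  obtain A' k k' s D where chart: "circular_chart A A' B k k' s D" .
  interpret circular_chart A A' B k k' s D by (rule chart)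
  define m where "m j = q j + p j" for j
  define f where "f j h = h ^ m j * K (q j) (p j) (sqrt h)" for j h
  have "\<exists>h0>0. h0 \<le> R\<^sup>2 \<and> ereal h0 \<le> hbar"
  proof (cases hbar)
    case (real c)
    then show ?thesis using R_pos assms(10) by (intro exI[of _ "min (R\<^sup>2) c"]) auto
  qed (use R_pos assms(10) in \<open>auto intro!: exI[of _ "R\<^sup>2"]\<close>)
  then obtain h0 where h0: "0 < h0" "h0 \<le> R\<^sup>2" "ereal h0 \<le> hbar" by blast
  \<comment> \<open>On the whole interval \<open>{0<..<h0}\<close> the integral is an explicit
    function of \<open>h\<close>, whatever orbits and starting points \<open>\<gamma>\<close>
    selects; since the interval is open, derivatives carry over as well.\<close>
  have J: "abelian_integral l q p d \<gamma> T h = (\<Sum>j=0..l. d j * f j h)" if h: "h \<in> {0<..<h0}" for d h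
  proof -
    have "ereal h < ereal h0" using h by simp
    then have "ereal h < hbar" using h0(3) by (rule less_le_trans)
    with h have "0 < h \<and> ereal h < hbar" by simp
    then have orbit: "periodic_solution I (\<lambda>x y. A x * y ^ 2 + B x) (\<gamma> h) (T h)"
      "range (\<gamma> h) \<subseteq> {(x, y). A x * y ^ 2 + B x = h}" "(0, 0) \<in> inside (range (\<gamma> h))"
      using assms(11) unfolding periodic_orbits_around_origin_def assms(9) by blast+
    show ?thesis
      unfolding f_def m_def using h h0(2) assms(13)
      by (intro abelian_integral_eq[where \<gamma> = \<gamma> and T = T, OF orbit]) auto
  qed
  have "\<forall>j\<in>{0..l}. \<exists>f'. (\<forall>h\<in>{0<..<h0}. (f j has_real_derivative f' h) (at h)) \<and> continuous_on {0<..<h0} f' \<and>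
      ((\<lambda>h. f j h / h ^ m j) \<longlongrightarrow> K (q j) (p j) 0) (at_right 0) \<and>
      ((\<lambda>h. h * f' h / h ^ m j) \<longlongrightarrow> m j * K (q j) (p j) 0) (at_right 0)"
  proof
    fix j assume j: "j \<in> {0..l}"
    obtain K' where K': "(\<forall>r\<in>{-R<..<R}. (K (q j) (p j) has_real_derivative K' r) (at r)) \<and>
        continuous_on {-R<..<R} K'"
      using K_C1[of "q j" "p j"] unfolding C1_on_def by (rule exE)
    have "1 \<le> m j" using assms(13)[of j] j by (simp add: m_def)
    note asym = power_times_sqrt_asymptotics[OF R_pos this, where K = "K (q j) (p j)" and K' = K']
    have K'1: "(K (q j) (p j) has_real_derivative K' r) (at r)" if "r \<in> {-R<..<R}" for r
      using K' that by simp
    have K'2: "continuous_on {-R<..<R} K'" using K' by simp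
    have sub: "{0<..<h0} \<subseteq> {0<..<R\<^sup>2}" using h0(2) by auto
    have f: "f j = (\<lambda>h. h ^ m j * K (q j) (p j) (sqrt h))" by (simp add: f_def fun_eq_iff)
    show "\<exists>f'. (\<forall>h\<in>{0<..<h0}. (f j has_real_derivative f' h) (at h)) \<and> continuous_on {0<..<h0} f' \<and>
      ((\<lambda>h. f j h / h ^ m j) \<longlongrightarrow> K (q j) (p j) 0) (at_right 0) \<and>
      ((\<lambda>h. h * f' h / h ^ m j) \<longlongrightarrow> m j * K (q j) (p j) 0) (at_right 0)"
      unfolding f
    proof (intro exI conjI ballI)
      fix h assume "h \<in> {0<..<h0}"
      then have "h \<in> {0<..<R\<^sup>2}" using sub by blast
      with K'1 K'2 show "((\<lambda>h. h ^ m j * K (q j) (p j) (sqrt h)) has_real_derivative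
          (real (m j) * h ^ (m j - 1) * K (q j) (p j) (sqrt h) +
          h ^ m j * (K' (sqrt h) / (2 * sqrt h)))) (at h)"
        by (rule asym(1))
    next
      show "continuous_on {0<..<h0} (\<lambda>h. real (m j) * h ^ (m j - 1) * K (q j) (p j) (sqrt h) +
          h ^ m j * (K' (sqrt h) / (2 * sqrt h)))"
        using asym(2)[OF K'1 K'2] sub by (rule continuous_on_subset)
    qed (rule asym(3,4)[OF K'1 K'2]; assumption)+
  qed
  from bchoice[OF this] obtain f' where
    f': "\<forall>j\<in>{0..l}. (\<forall>h\<in>{0<..<h0}. (f j has_real_derivative f' j h) (at h)) \<and>
      continuous_on {0<..<h0} (f' j) \<and> ((\<lambda>h. f j h / h ^ m j) \<longlongrightarrow> K (q j) (p j) 0) (at_right 0) \<and>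
      ((\<lambda>h. h * f' j h / h ^ m j) \<longlongrightarrow> m j * K (q j) (p j) 0) (at_right 0)" ..
  have "\<exists>d Z k. finite Z \<and> Suc (card Z) = card {0..l} \<and> Z \<subseteq> {0<..<h0} \<and>
      (\<forall>z\<in>Z. (\<Sum>j\<in>{0..l}. d j * f j z) = 0 \<and> (\<Sum>j\<in>{0..l}. d j * f' j z) \<noteq> 0) \<and>
      k \<in> {0..l} \<and> (\<forall>j\<in>{0..l}. m k \<le> m j) \<and> d k \<noteq> 0"
  proof (rule exists_simple_zeros[where c = "\<lambda>j. K (q j) (p j) 0"])
    show "inj_on m {0..l}" using assms(14) by (simp add: m_def[abs_def])
    show "K (q j) (p j) 0 \<noteq> 0" for j using K_pos[of "q j" "p j"] by simp
  qed (use f' h0(1) in simp_all)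
  then obtain d Z where Z: "finite Z" "card Z = l" "Z \<subseteq> {0<..<h0}"
    and zero: "\<And>z. z \<in> Z \<Longrightarrow> (\<Sum>j=0..l. d j * f j z) = 0 \<and> (\<Sum>j=0..l. d j * f' j z) \<noteq> 0"
    by auto
  have "simple_zero (abelian_integral l q p d \<gamma> T) z" if "z \<in> Z" for z
  proof -
    have z: "z \<in> {0<..<h0}" using Z that by blast
    have "((\<lambda>h. \<Sum>j=0..l. d j * f j h) has_real_derivative (\<Sum>j=0..l. d j * f' j z)) (at z)"
      using f' z by (intro DERIV_sum DERIV_cmult) simp
    then have "(abelian_integral l q p d \<gamma> T has_real_derivative (\<Sum>j=0..l. d j * f' j z)) (at z)"
      by (rule has_field_derivative_transform_within_open[OF _ open_greaterThanLessThan z]) (simp add: J)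
    then show ?thesis
      using zero[OF that] J[OF z] unfolding simple_zero_def by auto
  qed
  moreover have "0 < z \<and> ereal z < hbar" if "z \<in> Z" for z
  proof -
    have z: "0 < z" "ereal z < ereal h0" using Z that by auto
    then show ?thesis using less_le_trans[OF z(2) h0(3)] by simp
  qed
  ultimately show ?thesis using Z by blast
qed

end
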